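(* For real $y$ put $s_0=1+iy$ and let $D(s_0,\frac12)$ be the open disk of center $s_0$ and radius $\frac12$. The Riemann hypothesis is equivalent to each of the following statements: (1) for every real $y$, the Taylor series $b_0+b_1(s-s_0)+b_2(s-s_0)^2+\cdots$ of $(s-1)\zeta(s)\Gamma(s)$ at $s_0$ has no zero in $D(s_0,\frac12)$; (2) for every real $y$, the radius of convergence of the power series $c_0+c_1(s-s_0)+c_2(s-s_0)^2+\cdots$ of $\frac{1}{(s-1)\zeta(s)\Gamma(s)}$ at $s_0$ is at least $\frac12$.
   Context: $\zeta$ is the Riemann zeta function and $\Gamma$ the gamma function. The function $(s-1)\zeta(s)\Gamma(s)$ is analytic for $\Re(s)>0$ (with value $1$ at $s=1$). The Riemann hypothesis is the statement that all zeros of $\zeta$ with $0<\Re(s)<1$ have real part $\frac12$. With $\phi(t)=\frac{t}{(1-e^{-t})^2}-\frac{1}{1-e^{-t}}$, the Taylor coefficients at $s_0=1+iy$ are $b_n=\frac{1}{n!}\int_0^\infty\phi(t)e^{-t}(\log t)^n t^{iy}\,dt$. In particular $b_0=iy\,\zeta(1+iy)\Gamma(1+iy)$, read as $1$ when $y=0$. Since $\zeta$ has no zeros on the line $\Re(s)=1$, $b_0\neq0$ for all real $y$, so the reciprocal power series, with coefficients $c_n$, is well defined: $c_n$ is determined by $\big(\sum_n b_n(s-s_0)^n\big)\big(\sum_n c_n (s-s_0)^n\big)=1$. *)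

theory Defs
  imports "HOL-Complex_Analysis.Complex_Analysis"
begin

(* The Riemann zeta function is the analytic continuation of the Dirichlet series to the plane
   without the pole 1. By the identity theorem these conditions determine it; the value at the
   pole is only a convention to make the function total. *)
definition riemann_zeta :: "complex \<Rightarrow> complex" where
  "riemann_zeta = (THE f. f holomorphic_on (- {1}) \<and>
     (\<forall>s. Re s > 1 \<longrightarrow> (\<lambda>n. 1 / of_nat (Suc n) powr s) sums f s) \<and>
     f 1 = 0)"

definition riemann_hypothesis :: bool where
  "riemann_hypothesis \<longleftrightarrow>
     (\<forall>s. 0 < Re s \<and> Re s < 1 \<and> riemann_zeta s = 0 \<longrightarrow> Re s = 1 / 2)"

(* The value 1 at s = 1 removes the singularity there, so the function is analytic for Re s > 0. *)
definition zeta_Gamma :: "complex \<Rightarrow> complex" where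
  "zeta_Gamma s = (if s = 1 then 1 else (s - 1) * riemann_zeta s * Gamma s)"

definition s0 :: "real \<Rightarrow> complex" where
  "s0 y = Complex 1 y"

definition b_series :: "real \<Rightarrow> complex fps" where
  "b_series y = fps_expansion zeta_Gamma (s0 y)"

(* The constant coefficient of b_series y is non-zero because zeta has no zeros with real part 1,
   so the reciprocal below is the unique c with b_series y * c = 1. *)
definition c_series :: "real \<Rightarrow> complex fps" where
  "c_series y = inverse (b_series y)"

end

theory Submission
  imports Defs "HOL-Real_Asymp.Real_Asymp"
begin

text \<open>
  The function \<open>(s - 1) \<zeta>(s) \<Gamma>(s)\<close> is holomorphic for \<open>Re s > 0\<close>, so its Taylor series at \<open>1 + iy\<close> represents it on the
  disk of radius \<open>1\<close>. Since Gamma has no zeros, the condition on the Taylor series says that zeta has no zeros in the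
  union of the disks of radius \<open>1 / 2\<close>, which is the strip \<open>1 / 2 < Re s < 3 / 2\<close>. Zeta has no zeros with \<open>1 \<le> Re s\<close>, and by the functional equation
  its zeros in the critical strip are symmetric under \<open>s \<mapsto> 1 - s\<close>; hence this is the Riemann hypothesis
  (\<open>riemann_hypothesis_iff_b_series\<close>). The equivalence with the condition on the radius
  of convergence holds disk by disk and is a general fact about reciprocals of power series (\<open>conv_radius_c_series_iff\<close>).

  The facts about zeta that this uses come about as follows. The function \<open>h(s) = (s - 1) \<zeta>(s)\<close>,
  called \<open>zeta_reg\<close> below, is given for \<open>Re s > 0\<close> by a series of elementary functions that compares the
  sum of \<open>n powr (-s)\<close> with an integral. It is not zero for \<open>1 \<le> Re s\<close> by the Euler product and the
  inequality \<open>3 + 4 cos \<theta> + cos 2\<theta> \<ge> 0\<close> (\<open>zeta_reg_nonzero\<close>).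

  For the functional equation, write \<open>E(\<phi>)\<close> for the difference between the integral of a decreasing function \<open>\<phi>\<close> over the
  positive reals and the sum of its values at the positive integers. For \<open>x > 0\<close> one has
  \<open>E(exp (-ux)) = 1 / x - 1 / (exp x - 1) = E(2x / (x\<^sup>2 + (2\<pi>u)\<^sup>2))\<close>,
  where \<open>u\<close> is the variable to which \<open>E\<close> applies; the first equality is a geometric series, the
  second one the partial fraction expansion of the hyperbolic cotangent. Take the Mellin transform in \<open>x\<close> at
  a real \<open>s\<close> between \<open>0\<close> and \<open>1\<close>. All integrands are nonnegative, so Tonelli's theorem allows
  the transform to be taken inside \<open>E\<close>; it turns the kernels into multiples of \<open>u powr (-s)\<close> and of
  \<open>u powr (s - 1)\<close>. Since \<open>E(u powr (-s)) = -\<zeta>(s)\<close>, this relates \<open>\<zeta>(s)\<close> to \<open>\<zeta>(1 - s)\<close>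
  (\<open>zeta_reg_functional_equation_real\<close>). The identity theorem extends the relation to the critical strip,
  where it yields the symmetry of the zeros. It also continues zeta to the left of the strip, which shows that
  the function characterised in the definition of \<open>riemann_zeta\<close> exists and that it is \<open>h(s) / (s - 1)\<close>
  for \<open>Re s > 0\<close> (\<open>riemann_zeta_eq\<close>).
\<close>

section \<open>The zeta function with its pole removed\<close>

text \<open>
  Since \<^term>\<open>(s - 1) * of_nat (Suc n) powr (-s)\<close> is minus the derivative of \<open>x powr (1 - s)\<close> at the
  right end point of the interval from \<open>n\<close> to \<open>n + 1\<close>, the term is an error of second order in the mean value
  theorem. The differences of powers telescope to \<open>0\<close> when \<open>Re s > 1\<close>, so that the sum of all terms is then
  \<open>(s - 1) \<zeta>(s)\<close>. The term for \<open>n = 0\<close> is \<open>s\<close>, because \<open>0 powr z = 0\<close>.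
\<close>

definition zeta_reg_term :: "nat \<Rightarrow> complex \<Rightarrow> complex" where
  "zeta_reg_term n s =
     of_nat (Suc n) powr (1 - s) - of_nat n powr (1 - s) + (s - 1) * of_nat (Suc n) powr (-s)"

definition zeta_reg :: "complex \<Rightarrow> complex" where
  "zeta_reg s = (\<Sum>n. zeta_reg_term n s)"

lemma norm_of_nat_powr: "n > 0 \<Longrightarrow> norm (of_nat n powr s :: complex) = real n powr Re s"
  by (metis Re_complex_of_real norm_powr_real_powr of_nat_0_le_iff of_real_of_nat_eq of_nat_0_less_iff Reals_of_nat complex_Re_of_nat)

lemma norm_powr_diff_le:
  fixes s :: complex
  assumes "Re s > 0" "n > 0" "t \<in> {real n..real (Suc n)}"
  shows "norm (of_real t powr (-s) - of_nat (Suc n) powr (-s)) \<le> norm s * real n powr (-Re s - 1)"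
proof -
  define S where "S = complex_of_real ` {real n..real (Suc n)}"
  have conv: "convex S"
    unfolding S_def by (intro convex_linear_image linear_of_real) auto
  have "norm (complex_of_real t powr (-s) - of_real (real (Suc n)) powr (-s)) \<le>
          (norm s * real n powr (-Re s - 1)) * norm (complex_of_real t - of_real (real (Suc n)))"
  proof (rule field_differentiable_bound[OF conv])
    fix z assume z: "z \<in> S"
    then obtain u where u: "z = of_real u" "u \<ge> real n" by (auto simp: S_def)
    hence "u > 0" using assms by simp
    hence nz: "z \<notin> \<real>\<^sub>\<le>\<^sub>0" using u by (simp add: complex_nonpos_Reals_iff)
    show "((\<lambda>z. z powr (-s)) has_field_derivative (-s * z powr (-s - 1))) (at z within S)"
      using nz by (auto intro!: derivative_eq_intros)
    have "norm (z powr (-s - 1)) = u powr (-Re s - 1)"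
      using \<open>u > 0\<close> u by (simp add: norm_powr_real_powr)
    also have "\<dots> \<le> real n powr (-Re s - 1)"
      using assms u by (intro powr_mono2') auto
    finally show "norm (-s * z powr (-s - 1)) \<le> norm s * real n powr (-Re s - 1)"
      by (simp add: norm_mult mult_left_mono)
  next
    show "of_real t \<in> S" "complex_of_real (real (Suc n)) \<in> S"
      unfolding S_def by (rule imageI, use assms in simp)+
  qed
  also have "norm (complex_of_real t - of_real (real (Suc n))) = \<bar>t - real (Suc n)\<bar>"
    by (metis norm_of_real of_real_diff)
  also have "(norm s * real n powr (-Re s - 1)) * \<bar>t - real (Suc n)\<bar> \<le>
             (norm s * real n powr (-Re s - 1)) * 1"
    using assms by (intro mult_left_mono) auto
  finally show ?thesis by simp
qed

text \<open>
  The derivative of \<open>z powr (1 - s) + (s - 1) w z\<close> with \<open>w = (n + 1) powr (-s)\<close> vanishes at \<open>n + 1\<close>, and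
  by the preceding lemma it stays small on the whole interval. A second use of the mean value inequality gains
  the extra factor \<open>1 / n\<close> over the size of the single summands, which is what makes the series converge up to
  \<open>Re s > 0\<close>.
\<close>

lemma norm_zeta_reg_term_le:
  assumes "Re s > 0" "n > 0"
  shows "norm (zeta_reg_term n s) \<le> norm s * norm (s - 1) * real n powr (-Re s - 1)"
proof -
  define S where "S = complex_of_real ` {real n..real (Suc n)}"
  define w where "w = complex_of_nat (Suc n) powr (-s)"
  have conv: "convex S"
    unfolding S_def by (intro convex_linear_image linear_of_real) auto
  define f where "f = (\<lambda>z::complex. z powr (1 - s) + (s - 1) * w * z)"
  have "norm (f (of_nat (Suc n)) - f (of_nat n)) \<le>
          (norm s * norm (s - 1) * real n powr (-Re s - 1)) * norm (of_nat (Suc n) - of_nat n :: complex)"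
  proof (rule field_differentiable_bound[OF conv])
    fix z assume z: "z \<in> S"
    then obtain u where u: "z = of_real u" "u \<in> {real n..real (Suc n)}" by (auto simp: S_def)
    hence "u > 0" using assms by simp
    hence nz: "z \<notin> \<real>\<^sub>\<le>\<^sub>0" using u by (simp add: complex_nonpos_Reals_iff)
    show "(f has_field_derivative ((1 - s) * (z powr (-s) - w))) (at z within S)"
      unfolding f_def using nz by (auto intro!: derivative_eq_intros simp: algebra_simps)
    have "norm (z powr (-s) - w) \<le> norm s * real n powr (-Re s - 1)"
      unfolding w_def u(1) using assms u by (intro norm_powr_diff_le) auto
    hence "norm (1 - s) * norm (z powr (-s) - w) \<le> norm (1 - s) * (norm s * real n powr (-Re s - 1))"
      by (intro mult_left_mono) auto
    thus "norm ((1 - s) * (z powr (-s) - w)) \<le> norm s * norm (s - 1) * real n powr (-Re s - 1)"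
      by (simp add: norm_mult norm_minus_commute mult_ac)
  next
    have "complex_of_real (real n) \<in> S" "complex_of_real (real (Suc n)) \<in> S"
      unfolding S_def by (rule imageI, simp)+
    thus "of_nat n \<in> S" "of_nat (Suc n) \<in> S" by simp_all
  qed
  also have "f (of_nat (Suc n)) - f (of_nat n) = zeta_reg_term n s"
    by (simp add: f_def zeta_reg_term_def w_def algebra_simps)
  finally show ?thesis by simp
qed

lemma uniform_limit_zeta_reg:
  assumes "0 < \<delta>" and S: "\<And>s. s \<in> S \<Longrightarrow> \<delta> \<le> Re s \<and> norm s \<le> R"
  shows "uniform_limit S (\<lambda>n s. \<Sum>i<n. zeta_reg_term i s) zeta_reg sequentially"
  unfolding zeta_reg_def
proof (rule Weierstrass_m_test_ev)
  show "summable (\<lambda>n. R * (R + 1) * real n powr (-\<delta> - 1))"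
    using assms by (intro summable_mult) (simp add: summable_real_powr_iff)
  show "\<forall>\<^sub>F n in sequentially. \<forall>s\<in>S. norm (zeta_reg_term n s) \<le> R * (R + 1) * real n powr (-\<delta> - 1)"
    using eventually_gt_at_top[of 0]
  proof eventually_elim
    case (elim n)
    show ?case
    proof
      fix s assume s: "s \<in> S"
      have "norm s \<le> R" "norm (s - 1) \<le> R + 1"
        using S[OF s] norm_triangle_ineq4[of s 1] by simp_all
      hence "norm s * norm (s - 1) \<le> R * (R + 1)"
        using order_trans[OF norm_ge_zero \<open>norm s \<le> R\<close>] by (intro mult_mono) auto
      moreover have "real n powr (-Re s - 1) \<le> real n powr (-\<delta> - 1)"
        using S[OF s] elim by (intro powr_mono) auto
      moreover have "norm (zeta_reg_term n s) \<le> norm s * norm (s - 1) * real n powr (-Re s - 1)"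
        using S[OF s] assms(1) elim by (intro norm_zeta_reg_term_le) auto
      ultimately show "norm (zeta_reg_term n s) \<le> R * (R + 1) * real n powr (-\<delta> - 1)"
        by (meson mult_mono norm_ge_zero mult_nonneg_nonneg order_trans powr_ge_zero)
    qed
  qed
qed

lemma zeta_reg_term_sums:
  assumes "Re s > 0"
  shows "(\<lambda>n. zeta_reg_term n s) sums zeta_reg s"
proof -
  have "uniform_limit {s} (\<lambda>n s. \<Sum>i<n. zeta_reg_term i s) zeta_reg sequentially"
    by (rule uniform_limit_zeta_reg[of "Re s" _ "norm s"]) (use assms in auto)
  thus ?thesis unfolding sums_def by (simp add: tendsto_uniform_limitI)
qed

lemma holomorphic_zeta_reg_term: "zeta_reg_term n holomorphic_on A"
proof (cases n)
  case 0
  have "zeta_reg_term 0 = (\<lambda>s. s)" by (auto simp: zeta_reg_term_def fun_eq_iff)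
  thus ?thesis using 0 by simp
next
  case (Suc m)
  thus ?thesis unfolding zeta_reg_term_def
    by (intro holomorphic_intros) (auto simp del: of_nat_Suc)
qed

lemma holomorphic_zeta_reg: "zeta_reg holomorphic_on {s. Re s > 0}"
proof (rule holomorphic_uniform_sequence)
  show "open {s. Re s > 0}" by (rule open_halfspace_Re_gt)
  show "(\<lambda>s. \<Sum>i<n. zeta_reg_term i s) holomorphic_on {s. Re s > 0}" for n
    by (intro holomorphic_intros holomorphic_zeta_reg_term)
  fix x assume x: "x \<in> {s. 0 < Re s}"
  have re: "Re s \<ge> Re x / 2" if "s \<in> cball x (Re x / 2)" for s
    using that abs_Re_le_cmod[of "x - s"] by (auto simp: dist_norm)
  have nm: "norm s \<le> norm x + Re x / 2" if "s \<in> cball x (Re x / 2)" for s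
    using that norm_triangle_ineq2[of s x] by (auto simp: dist_norm norm_minus_commute)
  show "\<exists>d>0. cball x d \<subseteq> {s. 0 < Re s} \<and>
          uniform_limit (cball x d) (\<lambda>n s. \<Sum>i<n. zeta_reg_term i s) zeta_reg sequentially"
  proof (intro exI[of _ "Re x / 2"] conjI subsetI)
    show "uniform_limit (cball x (Re x / 2)) (\<lambda>n s. \<Sum>i<n. zeta_reg_term i s) zeta_reg sequentially"
      by (rule uniform_limit_zeta_reg[of "Re x / 2" _ "norm x + Re x / 2"]) (use x re nm in auto)
    show "s \<in> {s. 0 < Re s}" if "s \<in> cball x (Re x / 2)" for s
      using re[OF that] x by simp
  qed (use x in auto)
qed

lemma zeta_reg_1 [simp]: "zeta_reg 1 = 1"
proof -
  have "zeta_reg_term n 1 = (if n = 0 then 1 else 0)" for n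
    by (cases n) (simp_all add: zeta_reg_term_def del: of_nat_Suc)
  hence "(\<lambda>n. zeta_reg_term n 1) sums 1"
    using sums_single[of 0 "\<lambda>_. 1::complex"] by simp
  thus ?thesis using zeta_reg_term_sums[of 1] sums_unique2 by force
qed

lemma tendsto_of_nat_powr_0:
  assumes "Re s < 0"
  shows "(\<lambda>n. of_nat n powr s :: complex) \<longlonglongrightarrow> 0"
proof (rule Lim_null_comparison)
  show "\<forall>\<^sub>F n in sequentially. norm (of_nat n powr s :: complex) \<le> real n powr Re s"
    using eventually_gt_at_top[of 0] by eventually_elim (simp add: norm_of_nat_powr)
  show "(\<lambda>n. real n powr Re s) \<longlonglongrightarrow> 0"
    using assms by (intro tendsto_neg_powr filterlim_real_sequentially)
qed

lemma dirichlet_series_sums: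
  assumes "Re s > 1"
  shows "(\<lambda>n. 1 / of_nat (Suc n) powr s) sums (zeta_reg s / (s - 1))"
proof -
  have "(\<lambda>n. of_nat (Suc n) powr (1 - s) - of_nat n powr (1 - s) :: complex) sums (0 - of_nat 0 powr (1 - s))"
    using assms by (intro telescope_sums tendsto_of_nat_powr_0) auto
  hence "(\<lambda>n. zeta_reg_term n s - (of_nat (Suc n) powr (1 - s) - of_nat n powr (1 - s))) sums (zeta_reg s - 0)"
    using assms by (intro sums_diff zeta_reg_term_sums) auto
  hence "(\<lambda>n. ((s - 1) * of_nat (Suc n) powr (-s)) / (s - 1)) sums (zeta_reg s / (s - 1))"
    by (intro sums_divide) (simp add: zeta_reg_term_def)
  moreover have "s \<noteq> 1" using assms by auto
  ultimately show ?thesis by (simp add: powr_minus_divide)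
qed

section \<open>Euler product and non-vanishing to the right of the critical strip\<close>

definition rough_numbers :: "nat \<Rightarrow> nat set" where
  "rough_numbers N = {n. n > 0 \<and> (\<forall>p. prime p \<and> p < N \<longrightarrow> \<not> p dvd n)}"

lemma rough_numbers_Suc:
  assumes "prime p"
  shows "rough_numbers p = rough_numbers (Suc p) \<union> (\<lambda>n. p * n) ` rough_numbers p"
    and "rough_numbers (Suc p) \<inter> (\<lambda>n. p * n) ` rough_numbers p = {}"
proof -
  show "rough_numbers (Suc p) \<inter> (\<lambda>n. p * n) ` rough_numbers p = {}"
    using assms by (auto simp: rough_numbers_def)
  show "rough_numbers p = rough_numbers (Suc p) \<union> (\<lambda>n. p * n) ` rough_numbers p"
  proof (intro equalityI subsetI)
    fix n assume n: "n \<in> rough_numbers p"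
    show "n \<in> rough_numbers (Suc p) \<union> (\<lambda>n. p * n) ` rough_numbers p"
    proof (cases "p dvd n")
      case True
      then obtain m where m: "n = p * m" by auto
      hence "m \<in> rough_numbers p" using n by (auto simp: rough_numbers_def)
      thus ?thesis using m by auto
    next
      case False
      thus ?thesis using n by (auto simp: rough_numbers_def less_Suc_eq)
    qed
  next
    fix n assume "n \<in> rough_numbers (Suc p) \<union> (\<lambda>n. p * n) ` rough_numbers p"
    thus "n \<in> rough_numbers p"
    proof
      assume "n \<in> rough_numbers (Suc p)"
      thus ?thesis by (auto simp: rough_numbers_def)
    next
      assume "n \<in> (\<lambda>n. p * n) ` rough_numbers p"
      then obtain m where m: "n = p * m" "m \<in> rough_numbers p" by auto
      have "\<not> q dvd p * m" if "prime q" "q < p" for q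
        using that m assms primes_dvd_imp_eq[of q p]
        by (auto simp: rough_numbers_def prime_dvd_mult_iff)
      thus ?thesis using m assms by (auto simp: rough_numbers_def prime_gt_0_nat)
    qed
  qed
qed

lemma summable_on_of_nat_powr:
  assumes "Re s > 1"
  shows "(\<lambda>n. of_nat n powr (-s) :: complex) summable_on A"
proof -
  have "(\<lambda>n. norm (of_nat n powr (-s) :: complex)) = (\<lambda>n. real n powr (-Re s))"
  proof
    fix n show "norm (of_nat n powr (-s) :: complex) = real n powr (-Re s)"
      by (cases "n = 0") (auto simp: norm_of_nat_powr)
  qed
  hence "summable (\<lambda>n. norm (of_nat n powr (-s) :: complex))"
    using assms by (simp add: summable_real_powr_iff)
  hence "(\<lambda>n. of_nat n powr (-s) :: complex) summable_on UNIV"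
    by (rule norm_summable_imp_summable_on)
  thus ?thesis by (rule summable_on_subset_banach) auto
qed

text \<open>
  Eratosthenes' sieve: multiplying the sum over the numbers without prime factor below \<open>p\<close> by
  \<open>1 - p powr (-s)\<close> removes exactly the multiples of \<open>p\<close>.
\<close>

lemma has_sum_rough_numbers:
  assumes "Re s > 1"
  shows "((\<lambda>n. of_nat n powr (-s)) has_sum
            (zeta_reg s / (s - 1) * (\<Prod>p | prime p \<and> p < N. 1 - of_nat p powr (-s)))) (rough_numbers N)"
proof (induction N)
  case 0
  have "((\<lambda>n. of_nat n powr (-s)) has_sum (\<Sum>\<^sub>\<infinity>n\<in>UNIV. of_nat n powr (-s))) UNIV"
    by (rule has_sum_infsum[OF summable_on_of_nat_powr[OF assms]])
  moreover from has_sum_imp_sums[OF this] have "(\<lambda>n. of_nat (Suc n) powr (-s)) sums (\<Sum>\<^sub>\<infinity>n\<in>UNIV. of_nat n powr (-s))"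
    by (subst sums_Suc_iff) simp
  hence "(\<Sum>\<^sub>\<infinity>n\<in>UNIV. of_nat n powr (-s)) = zeta_reg s / (s - 1)"
    using dirichlet_series_sums[OF assms] by (simp add: powr_minus_divide sums_unique2 del: of_nat_Suc)
  ultimately have "((\<lambda>n. of_nat n powr (-s)) has_sum (zeta_reg s / (s - 1))) UNIV" by simp
  also have "?this \<longleftrightarrow> ((\<lambda>n. of_nat n powr (-s)) has_sum (zeta_reg s / (s - 1))) (rough_numbers 0)"
    by (rule has_sum_cong_neutral) (auto simp: rough_numbers_def)
  finally show ?case by simp
next
  case (Suc N)
  show ?case
  proof (cases "prime N")
    case False
    have "{p. prime p \<and> p < Suc N} = {p. prime p \<and> p < N}" "rough_numbers (Suc N) = rough_numbers N"
      using False by (auto simp: less_Suc_eq rough_numbers_def)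
    thus ?thesis using Suc by simp
  next
    case True
    define Z where "Z = zeta_reg s / (s - 1) * (\<Prod>p | prime p \<and> p < N. 1 - of_nat p powr (-s))"
    have Z: "((\<lambda>n. of_nat n powr (-s)) has_sum Z) (rough_numbers N)" using Suc unfolding Z_def .
    have "N > 0" using True by (simp add: prime_gt_0_nat)
    have "((\<lambda>n. of_nat N powr (-s) * of_nat n powr (-s)) has_sum (of_nat N powr (-s) * Z)) (rough_numbers N)"
      by (rule has_sum_cmult_right[OF Z])
    also have "(\<lambda>n. of_nat N powr (-s) * of_nat n powr (-s) :: complex) = (\<lambda>n. of_nat n powr (-s)) \<circ> (\<lambda>n. N * n)"
      by (auto simp: fun_eq_iff powr_times_real)
    finally have mult: "((\<lambda>n. of_nat n powr (-s)) has_sum (of_nat N powr (-s) * Z)) ((\<lambda>n. N * n) ` rough_numbers N)"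
      using \<open>N > 0\<close> by (subst has_sum_reindex) (auto simp: inj_on_def o_def simp del: of_nat_mult)
    have "((\<lambda>n. of_nat n powr (-s)) has_sum (Z - of_nat N powr (-s) * Z))
            (rough_numbers N - (\<lambda>n. N * n) ` rough_numbers N)"
      by (rule has_sum_Diff[OF Z mult]) (use rough_numbers_Suc(1)[OF True] in blast)
    also have "rough_numbers N - (\<lambda>n. N * n) ` rough_numbers N = rough_numbers (Suc N)"
      using rough_numbers_Suc[OF True] by blast
    also have "{p. prime p \<and> p < Suc N} = insert N {p. prime p \<and> p < N}"
      using True by (auto simp: less_Suc_eq)
    hence "Z - of_nat N powr (-s) * Z =
             zeta_reg s / (s - 1) * (\<Prod>p | prime p \<and> p < Suc N. 1 - of_nat p powr (-s))"
      by (simp add: Z_def algebra_simps)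
    finally show ?thesis .
  qed
qed

lemma rough_number_ge:
  assumes "n \<in> rough_numbers N" "n \<noteq> 1"
  shows "n \<ge> N"
proof -
  obtain p where p: "prime p" "p dvd n" using prime_factor_nat[OF assms(2)] by blast
  have "p \<le> n" using p assms by (auto simp: rough_numbers_def intro: dvd_imp_le)
  moreover have "\<not> p < N" using p assms(1) unfolding rough_numbers_def by blast
  ultimately show ?thesis by linarith
qed

text \<open>
  What survives the sieve by the primes below \<open>N\<close> is \<open>1\<close> and numbers that are at least \<open>N\<close>, so the sieved sum
  tends to \<open>1\<close>. The product is written for the reciprocal of \<open>\<zeta>\<close>; a vanishing \<open>\<zeta>(s)\<close> would make the
  sieved sums vanish, against their limit \<open>1\<close>.
\<close>

lemma euler_product:
  assumes "Re s > 1"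
  shows "(\<lambda>N. \<Prod>p | prime p \<and> p < N. 1 - of_nat p powr (-s)) \<longlonglongrightarrow> (s - 1) / zeta_reg s"
    and "zeta_reg s \<noteq> 0"
proof -
  define Z where "Z = zeta_reg s / (s - 1)"
  define P where "P = (\<lambda>N. \<Prod>p | prime p \<and> p < N. 1 - of_nat p powr (-s) :: complex)"
  have real: "summable (\<lambda>n. real n powr (-Re s))"
    using assms by (simp add: summable_real_powr_iff)
  have bound: "norm (Z * P N - 1) \<le> (\<Sum>n. real (n + N) powr (-Re s))" if "N > 1" for N
  proof -
    have N: "((\<lambda>n. of_nat n powr (-s)) has_sum Z * P N) (rough_numbers N)"
      using has_sum_rough_numbers[OF assms] unfolding Z_def P_def .
    have "1 \<in> rough_numbers N" by (auto simp: rough_numbers_def)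
    hence "((\<lambda>n. of_nat n powr (-s)) has_sum (Z * P N - 1)) (rough_numbers N - {1})"
      by (intro has_sum_Diff[OF N]) (auto intro!: has_sum_finiteI)
    moreover have "((\<lambda>n. real n powr (-Re s)) has_sum (\<Sum>n. real (n + N) powr (-Re s))) {N..}"
    proof -
      have "((\<lambda>n. real (n + N) powr (-Re s)) has_sum (\<Sum>n. real (n + N) powr (-Re s))) UNIV"
        using summable_ignore_initial_segment[OF real, of N]
        by (intro sums_nonneg_imp_has_sum summable_sums) auto
      also have "?this \<longleftrightarrow> ?thesis"
        by (rule has_sum_reindex_bij_witness[of _ "\<lambda>n. n - N" "\<lambda>n. n + N"]) auto
      finally show ?thesis .
    qed
    moreover have "rough_numbers N - {1} \<subseteq> {N..}"
      using rough_number_ge by auto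
    moreover have "(\<lambda>n. real n powr (-Re s)) summable_on (rough_numbers N - {1})"
      by (rule summable_on_subset_banach[OF has_sum_imp_summable[OF calculation(2)] calculation(3)])
    then obtain T where T: "((\<lambda>n. real n powr (-Re s)) has_sum T) (rough_numbers N - {1})"
      by (auto simp: summable_on_def)
    ultimately have "T \<le> (\<Sum>n. real (n + N) powr (-Re s))"
      by (intro has_sum_mono'[OF T]) auto
    moreover have "norm (Z * P N - 1) \<le> T"
      using \<open>((\<lambda>n. of_nat n powr (-s)) has_sum (Z * P N - 1)) (rough_numbers N - {1})\<close> T
      by (rule norm_infsum_le) (auto simp: norm_of_nat_powr rough_numbers_def)
    ultimately show ?thesis by simp
  qed
  have "(\<lambda>N. Z * P N - 1) \<longlonglongrightarrow> 0"
  proof (rule Lim_null_comparison)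
    show "\<forall>\<^sub>F N in sequentially. norm (Z * P N - 1) \<le> (\<Sum>n. real (n + N) powr (-Re s))"
      using eventually_gt_at_top[of 1] by eventually_elim (rule bound)
    show "(\<lambda>N. \<Sum>n. real (n + N) powr (-Re s)) \<longlonglongrightarrow> 0"
      by (rule suminf_exist_split2[OF real])
  qed
  hence lim: "(\<lambda>N. Z * P N) \<longlonglongrightarrow> 1" by (simp add: LIM_zero_iff)
  have "Z \<noteq> 0"
  proof
    assume "Z = 0"
    with lim show False by (simp add: LIMSEQ_const_iff)
  qed
  thus "zeta_reg s \<noteq> 0" by (auto simp: Z_def)
  have "(\<lambda>N. Z * P N / Z) \<longlonglongrightarrow> 1 / Z"
    by (rule tendsto_divide[OF lim tendsto_const \<open>Z \<noteq> 0\<close>])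
  thus "(\<lambda>N. \<Prod>p | prime p \<and> p < N. 1 - of_nat p powr (-s)) \<longlonglongrightarrow> (s - 1) / zeta_reg s"
    using \<open>Z \<noteq> 0\<close> by (simp add: P_def Z_def)
qed

lemma ln_norm_one_minus_sums:
  assumes "norm (z :: complex) < 1"
  shows "(\<lambda>n. - Re (z ^ n) / real n) sums ln (norm (1 - z))"
proof -
  have "z \<noteq> 1" using assms by auto
  have "(\<lambda>n. - (z ^ n) / of_nat n) sums Ln (1 - z)"
    using Ln_series'[of "-z"] assms by simp
  hence "(\<lambda>n. Re (- (z ^ n) / of_nat n)) sums Re (Ln (1 - z))"
    by (rule sums_Re)
  thus ?thesis using \<open>z \<noteq> 1\<close> by (simp add: Re_divide_of_nat)
qed

text \<open>
  Expanding the logarithm, the \<open>n\<close>-th coefficient is a nonpositive multiple of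
  \<open>3 + 4 cos \<theta> + cos 2\<theta> = 2 (1 + cos \<theta>)\<^sup>2\<close>, where \<open>\<theta>\<close> is the argument of \<open>u ^ n\<close>.
\<close>

lemma three_four_one_local:
  fixes u :: complex
  assumes "0 \<le> x" "x < 1" "norm u = 1"
  shows "norm ((1 - of_real x) ^ 3 * (1 - of_real x * u) ^ 4 * (1 - of_real x * u ^ 2)) \<le> 1"
proof -
  have lt: "norm (complex_of_real x) < 1" "norm (of_real x * u) < 1" "norm (of_real x * u ^ 2) < 1"
    using assms by (auto simp: norm_mult norm_power)
  define L where "L = 3 * ln (norm (1 - complex_of_real x)) + 4 * ln (norm (1 - of_real x * u))
                        + ln (norm (1 - of_real x * u ^ 2))"
  have sums: "(\<lambda>n. 3 * (- Re (of_real x ^ n) / real n) + 4 * (- Re ((of_real x * u) ^ n) / real n)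
           + (- Re ((of_real x * u ^ 2) ^ n) / real n)) sums L"
    unfolding L_def
    by (rule sums_add[OF sums_add[OF sums_mult[OF ln_norm_one_minus_sums[OF lt(1)]]
          sums_mult[OF ln_norm_one_minus_sums[OF lt(2)]]] ln_norm_one_minus_sums[OF lt(3)]])
  have le: "3 * (- Re (of_real x ^ n) / real n) + 4 * (- Re ((of_real x * u) ^ n) / real n)
           + (- Re ((of_real x * u ^ 2) ^ n) / real n) \<le> 0" for n
  proof -
    define c where "c = Re (u ^ n)"
    have "norm (u ^ n) = 1" using assms by (simp add: norm_power)
    hence "(Re (u ^ n))\<^sup>2 + (Im (u ^ n))\<^sup>2 = 1" by (metis cmod_power2 one_power2)
    moreover have "(u ^ 2) ^ n = (u ^ n) ^ 2" by (simp add: power_mult [symmetric] mult.commute)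
    ultimately have c2: "Re ((u ^ 2) ^ n) = 2 * c\<^sup>2 - 1" unfolding c_def by (simp add: Re_power2)
    have *: "Re (of_real x ^ n) = x ^ n" "Re ((of_real x * u) ^ n) = x ^ n * c"
          "Re ((of_real x * u ^ 2) ^ n) = x ^ n * (2 * c\<^sup>2 - 1)"
      by (simp_all add: power_mult_distrib c2 flip: of_real_power c_def)
    have "3 * (- Re (of_real x ^ n) / real n) + 4 * (- Re ((of_real x * u) ^ n) / real n)
           + (- Re ((of_real x * u ^ 2) ^ n) / real n) = - (2 * x ^ n * (1 + c)\<^sup>2 / real n)"
      unfolding * by (cases "n = 0") (simp_all add: field_simps power2_eq_square)
    also have "\<dots> \<le> 0" using assms by simp
    finally show ?thesis .
  qed
  have "L \<le> 0" by (rule sums_le[OF le sums sums_zero])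
  have pos: "norm (1 - w) > 0" if "norm w < 1" for w :: complex
    using that by (cases "w = 1") auto
  have nz: "norm (1 - complex_of_real x) > 0" "norm (1 - of_real x * u) > 0" "norm (1 - of_real x * u ^ 2) > 0"
    using pos[OF lt(1)] pos[OF lt(2)] pos[OF lt(3)] .
  have "L = ln (norm ((1 - of_real x) ^ 3 * (1 - of_real x * u) ^ 4 * (1 - of_real x * u ^ 2)))"
    unfolding L_def norm_mult norm_power using nz by (simp add: ln_mult_pos ln_realpow)
  with \<open>L \<le> 0\<close> nz show ?thesis
    by (simp add: norm_mult norm_power ln_le_zero_iff)
qed

text \<open>
  The local inequality for each Euler factor, multiplied over all primes, is the classical
  \<open>\<bar>\<zeta>(\<sigma>)\<^sup>3 \<zeta>(\<sigma> + it)\<^sup>4 \<zeta>(\<sigma> + 2it)\<bar> \<ge> 1\<close>, written here without division.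
\<close>

lemma three_four_one:
  assumes "\<sigma> > 1"
  shows "norm (Complex \<sigma> 0 - 1) ^ 3 * norm (Complex \<sigma> t - 1) ^ 4 * norm (Complex \<sigma> (2 * t) - 1) \<le>
         norm (zeta_reg (Complex \<sigma> 0)) ^ 3 * norm (zeta_reg (Complex \<sigma> t)) ^ 4 *
         norm (zeta_reg (Complex \<sigma> (2 * t)))"
proof -
  define P where "P = (\<lambda>s N. \<Prod>p | prime p \<and> p < N. 1 - of_nat p powr (-s) :: complex)"
  define Q where "Q = (\<lambda>s. (s - 1) / zeta_reg s)"
  have P: "P (Complex \<sigma> y) \<longlonglongrightarrow> Q (Complex \<sigma> y)" for y
    unfolding P_def Q_def using assms by (intro euler_product) auto
  have local: "norm ((1 - of_nat p powr (- Complex \<sigma> 0)) ^ 3 * (1 - of_nat p powr (- Complex \<sigma> t)) ^ 4 *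
                 (1 - of_nat p powr (- Complex \<sigma> (2 * t))) :: complex) \<le> 1" if "prime p" for p
  proof -
    have p: "p > 1" using that by (rule prime_gt_1_nat)
    define x where "x = real p powr (-\<sigma>)"
    define u where "u = complex_of_nat p powr (Complex 0 (-t))"
    have u: "norm u = 1" using p by (simp add: u_def norm_of_nat_powr)
    have x: "0 \<le> x" "x < 1" using p assms by (auto simp: x_def powr_less_one)
    have x': "complex_of_nat p powr (- Complex \<sigma> 0) = of_real x"
    proof -
      have "- Complex \<sigma> 0 = of_real (-\<sigma>)" by (simp add: complex_eq_iff)
      thus ?thesis using powr_of_real[of "real p" "-\<sigma>"] by (simp add: x_def)
    qed
    have c1: "- Complex \<sigma> t = - Complex \<sigma> 0 + Complex 0 (-t)"
      and c2: "- Complex \<sigma> (2 * t) = - Complex \<sigma> 0 + 2 * Complex 0 (-t)"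
      by (simp_all add: complex_eq_iff)
    have u2: "complex_of_nat p powr (2 * Complex 0 (-t)) = u ^ 2"
      unfolding u_def mult_2 powr_add power2_eq_square ..
    have "complex_of_nat p powr (- Complex \<sigma> t) = of_real x * u"
      unfolding c1 powr_add x' u_def ..
    moreover have "complex_of_nat p powr (- Complex \<sigma> (2 * t)) = of_real x * u ^ 2"
      unfolding c2 powr_add x' u2 ..
    ultimately show ?thesis using three_four_one_local[OF x u] x' by simp
  qed
  have "norm (P (Complex \<sigma> 0) N ^ 3 * P (Complex \<sigma> t) N ^ 4 * P (Complex \<sigma> (2 * t)) N) \<le> 1" for N
  proof -
    have "P (Complex \<sigma> 0) N ^ 3 * P (Complex \<sigma> t) N ^ 4 * P (Complex \<sigma> (2 * t)) N =
      (\<Prod>p | prime p \<and> p < N. (1 - of_nat p powr (- Complex \<sigma> 0)) ^ 3 *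
         (1 - of_nat p powr (- Complex \<sigma> t)) ^ 4 * (1 - of_nat p powr (- Complex \<sigma> (2 * t))))"
      unfolding P_def by (simp only: prod.distrib prod_power_distrib)
    also have "norm \<dots> \<le> 1"
      unfolding prod_norm [symmetric] using local by (intro prod_le_1) simp_all
    finally show ?thesis .
  qed
  moreover have "(\<lambda>N. norm (P (Complex \<sigma> 0) N ^ 3 * P (Complex \<sigma> t) N ^ 4 * P (Complex \<sigma> (2 * t)) N))
     \<longlonglongrightarrow> norm (Q (Complex \<sigma> 0) ^ 3 * Q (Complex \<sigma> t) ^ 4 * Q (Complex \<sigma> (2 * t)))"
    by (intro tendsto_intros P)
  ultimately have "norm (Q (Complex \<sigma> 0) ^ 3 * Q (Complex \<sigma> t) ^ 4 * Q (Complex \<sigma> (2 * t))) \<le> 1"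
    by (intro LIMSEQ_le_const2[where a = 1]) auto
  moreover have "zeta_reg (Complex \<sigma> y) \<noteq> 0" for y using assms by (intro euler_product) auto
  ultimately show ?thesis
    unfolding Q_def by (simp add: norm_mult norm_divide norm_power power_divide divide_simps)
qed

text \<open>
  Mertens' argument. If \<open>\<zeta>(1 + it) = 0\<close> with \<open>t \<noteq> 0\<close>, then as \<open>\<sigma>\<close> decreases to \<open>1\<close> the right hand side of the
  3-4-1 inequality is of order \<open>(\<sigma> - 1) ^ 4\<close>, while the left hand side is at least of order \<open>(\<sigma> - 1) ^ 3\<close>.
\<close>

lemma zeta_reg_nonzero_line:
  assumes "Re s = 1"
  shows "zeta_reg s \<noteq> 0"
proof (cases "s = 1")
  case False
  define t where "t = Im s"
  have s: "s = Complex 1 t" using assms by (simp add: complex_eq_iff t_def)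
  have "t \<noteq> 0" using False s by (auto simp: complex_eq_iff)
  show ?thesis
  proof
    assume zero: "zeta_reg s = 0"
    define G where "G = (\<lambda>y \<sigma>. zeta_reg (Complex \<sigma> y))"
    have lim: "((\<lambda>\<sigma>. Complex \<sigma> y) \<longlongrightarrow> Complex 1 y) (at_right 1)" for y
      by (intro tendsto_intros)
    have cont: "isCont zeta_reg (Complex 1 y)" for y
      using holomorphic_on_imp_continuous_on[OF holomorphic_zeta_reg]
      by (rule continuous_on_interior) (simp add: open_halfspace_Re_gt interior_open)
    have G: "(G y \<longlongrightarrow> zeta_reg (Complex 1 y)) (at_right 1)" for y
      unfolding G_def by (rule isCont_tendsto_compose[OF cont lim])
    have "(zeta_reg has_field_derivative deriv zeta_reg s) (at s)"
      using holomorphic_zeta_reg by (rule holomorphic_derivI) (auto simp: open_halfspace_Re_gt assms)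
    hence "((\<lambda>z. (zeta_reg z - zeta_reg s) / (z - s)) \<longlongrightarrow> deriv zeta_reg s) (at s)"
      by (simp add: has_field_derivative_iff)
    moreover have "filterlim (\<lambda>\<sigma>. Complex \<sigma> t) (at s) (at_right 1)"
      unfolding s filterlim_at using lim[of t]
      by (auto simp: eventually_at_filter intro!: always_eventually)
    ultimately have "((\<lambda>\<sigma>. (zeta_reg (Complex \<sigma> t) - zeta_reg s) / (Complex \<sigma> t - s)) \<longlongrightarrow> deriv zeta_reg s) (at_right 1)"
      by (rule filterlim_compose)
    moreover have "Complex \<sigma> t - s = of_real (\<sigma> - 1)" for \<sigma> by (simp add: s complex_eq_iff)
    ultimately have D: "((\<lambda>\<sigma>. G t \<sigma> / of_real (\<sigma> - 1)) \<longlongrightarrow> deriv zeta_reg s) (at_right 1)"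
      using zero by (simp add: G_def)
    \<comment> \<open>The right hand side of the 3-4-1 inequality divided by \<open>(\<sigma> - 1) ^ 3\<close>, in a form whose limit is visible.\<close>
    define F where "F = (\<lambda>\<sigma>. norm (G 0 \<sigma>) ^ 3 * norm (G t \<sigma> / of_real (\<sigma> - 1)) ^ 4 * norm (G (2 * t) \<sigma>) * (\<sigma> - 1))"
    have "(F \<longlongrightarrow> norm (zeta_reg (Complex 1 0)) ^ 3 * norm (deriv zeta_reg s) ^ 4 *
                 norm (zeta_reg (Complex 1 (2 * t))) * (1 - 1)) (at_right 1)"
      unfolding F_def by (intro tendsto_intros G D)
    hence "(F \<longlongrightarrow> 0) (at_right 1)" by simp
    moreover have "eventually (\<lambda>\<sigma>. F \<sigma> \<ge> \<bar>t\<bar> ^ 4 * \<bar>2 * t\<bar>) (at_right 1)"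
      using eventually_at_right_less[of 1]
    proof eventually_elim
      case (elim \<sigma>)
      have "(\<sigma> - 1) ^ 3 * (\<bar>t\<bar> ^ 4 * \<bar>2 * t\<bar>) \<le>
        norm (Complex \<sigma> 0 - 1) ^ 3 * (norm (Complex \<sigma> t - 1) ^ 4 * norm (Complex \<sigma> (2 * t) - 1))"
        using abs_Re_le_cmod[of "Complex \<sigma> 0 - 1"] abs_Im_le_cmod[of "Complex \<sigma> t - 1"]
              abs_Im_le_cmod[of "Complex \<sigma> (2 * t) - 1"] elim
        by (intro mult_mono power_mono) auto
      also have "\<dots> \<le> norm (G 0 \<sigma>) ^ 3 * norm (G t \<sigma>) ^ 4 * norm (G (2 * t) \<sigma>)"
        using three_four_one[OF elim, of t] unfolding G_def by (simp add: mult_ac)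
      also have "\<dots> = (\<sigma> - 1) ^ 3 * F \<sigma>"
      proof -
        have "a * b * c = d ^ 3 * (a * (b / d ^ 4) * c * d)" if "d > 0" for a b c d :: real
          using that by (simp add: eval_nat_numeral)
        thus ?thesis using elim unfolding F_def norm_divide norm_of_real power_divide by simp
      qed
      finally show ?case using elim by simp
    qed
    ultimately have "0 \<ge> \<bar>t\<bar> ^ 4 * \<bar>2 * t\<bar>"
      by (intro tendsto_lowerbound[where F = "at_right (1::real)" and f = F]) auto
    thus False using \<open>t \<noteq> 0\<close> by (simp add: mult_le_0_iff)
  qed
qed simp

lemma zeta_reg_nonzero: "Re s \<ge> 1 \<Longrightarrow> zeta_reg s \<noteq> 0"
  using zeta_reg_nonzero_line[of s] euler_product(2)[of s] by (cases "Re s = 1") auto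

section \<open>The functional equation on the real interval from 0 to 1\<close>

text \<open>
  For decreasing \<open>\<phi>\<close> this is the amount by which the integral of \<open>\<phi>\<close> exceeds the sum of its values at the positive
  integers. It makes sense even where both are infinite, and its integrand is nonnegative, so that it may
  be exchanged with other integrals without any convergence hypothesis.
\<close>

definition excess :: "(real \<Rightarrow> real) \<Rightarrow> ennreal" where
  "excess \<phi> = (\<integral>\<^sup>+u\<in>{0<..}. ennreal (\<phi> u - \<phi> (real_of_int \<lceil>u\<rceil>)) \<partial>lborel)"

text \<open>
  The ceiling is constant between consecutive integers, so on each such interval the integrand has the explicit
  antiderivative \<open>\<Phi> u - u * \<phi> (n + 1)\<close>. Differentiability is only asked for \<open>u > 0\<close> because the powers to which
  this is applied are singular at \<open>0\<close>.
\<close>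

lemma excess_eq_suminf:
  fixes \<phi> \<Phi> :: "real \<Rightarrow> real"
  assumes [measurable]: "\<phi> \<in> borel_measurable borel"
    and mono: "\<And>u v. 0 < u \<Longrightarrow> u \<le> v \<Longrightarrow> \<phi> v \<le> \<phi> u"
    and cont: "continuous_on {0..} \<Phi>"
    and deriv: "\<And>u. u > 0 \<Longrightarrow> (\<Phi> has_real_derivative \<phi> u) (at u)"
    and sums: "(\<lambda>n. \<Phi> (real (Suc n)) - \<Phi> (real n) - \<phi> (real (Suc n))) sums S"
  shows "excess \<phi> = ennreal S" and "S \<ge> 0"
proof -
  define g where "g = (\<lambda>u. ennreal (\<phi> u - \<phi> (real_of_int \<lceil>u\<rceil>)))"
  define A where "A = (\<lambda>n. {real n<..real (Suc n)})"
  have [measurable]: "g \<in> borel_measurable borel" unfolding g_def by measurable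
  have ceil: "\<lceil>u\<rceil> = int (Suc n)" if "u \<in> A n" for u n
    using that unfolding A_def by (intro ceiling_unique) auto
  have disj: "disjoint_family A"
    unfolding disjoint_family_on_def using ceil by (metis disjoint_iff of_nat_eq_iff nat.inject)
  have UN: "(\<Union>n. A n) = {0<..}"
  proof (intro equalityI subsetI)
    fix u :: real assume "u \<in> {0<..}"
    hence u: "u > 0" by simp
    hence "\<lceil>u\<rceil> \<ge> 1" by simp
    define n where "n = nat (\<lceil>u\<rceil> - 1)"
    have "real n = of_int \<lceil>u\<rceil> - 1" using \<open>\<lceil>u\<rceil> \<ge> 1\<close> by (simp add: n_def)
    hence "u \<in> A n" unfolding A_def using ceiling_correct[of u] by auto
    thus "u \<in> (\<Union>n. A n)" by blast
  qed (auto simp: A_def)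
  have int: "(\<integral>\<^sup>+u. g u * indicator (A n) u \<partial>lborel) = ennreal (\<Phi> (real (Suc n)) - \<Phi> (real n) - \<phi> (real (Suc n)))"
    and nonneg: "\<Phi> (real (Suc n)) - \<Phi> (real n) - \<phi> (real (Suc n)) \<ge> 0" for n
  proof -
    define I where "I = {real n<..<real (Suc n)}"
    have "((\<lambda>u. \<phi> u - \<phi> (real (Suc n))) has_integral
            ((\<Phi> (real (Suc n)) - real (Suc n) * \<phi> (real (Suc n))) - (\<Phi> (real n) - real n * \<phi> (real (Suc n)))))
            {real n..real (Suc n)}"
    proof (rule fundamental_theorem_of_calculus_interior)
      show "continuous_on {real n..real (Suc n)} (\<lambda>u. \<Phi> u - u * \<phi> (real (Suc n)))"
        by (intro continuous_intros continuous_on_subset[OF cont]) auto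
      fix u assume "u \<in> {real n<..<real (Suc n)}"
      hence "u > 0" using of_nat_0_le_iff[of n] by (auto simp del: of_nat_0_le_iff)
      thus "((\<lambda>u. \<Phi> u - u * \<phi> (real (Suc n))) has_vector_derivative \<phi> u - \<phi> (real (Suc n))) (at u)"
        unfolding has_real_derivative_iff_has_vector_derivative [symmetric]
        by (auto intro!: derivative_eq_intros deriv)
    qed auto
    moreover have "(\<Phi> (real (Suc n)) - real (Suc n) * \<phi> (real (Suc n))) - (\<Phi> (real n) - real n * \<phi> (real (Suc n)))
        = \<Phi> (real (Suc n)) - \<Phi> (real n) - \<phi> (real (Suc n))"
      by (simp add: algebra_simps)
    ultimately have hi: "((\<lambda>u. \<phi> u - \<phi> (real (Suc n))) has_integral
         (\<Phi> (real (Suc n)) - \<Phi> (real n) - \<phi> (real (Suc n)))) I"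
      unfolding I_def by (simp only: has_integral_Icc_iff_Ioo)
    have nn: "\<phi> u - \<phi> (real (Suc n)) \<ge> 0" if "u \<in> I" for u
    proof -
      have "u > 0" "u \<le> real (Suc n)" using that of_nat_0_le_iff[of n] 
        by (auto simp: I_def simp del: of_nat_0_le_iff)
      thus ?thesis using mono[of u "real (Suc n)"] by simp
    qed
    have "(\<integral>\<^sup>+u. g u * indicator (A n) u \<partial>lborel) =
          (\<integral>\<^sup>+u. ennreal (\<phi> u - \<phi> (real (Suc n))) * indicator I u \<partial>lborel)"
    proof (intro nn_integral_cong)
      fix u :: real
      consider "u \<in> I" | "u = real (Suc n)" | "u \<notin> A n" by (force simp: I_def A_def)
      thus "g u * indicator (A n) u = ennreal (\<phi> u - \<phi> (real (Suc n))) * indicator I u"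
      proof cases
        case 1
        hence "u \<in> A n" by (auto simp: I_def A_def)
        thus ?thesis using 1 ceil[of u n] by (simp add: g_def)
      next
        \<comment> \<open>At the right end point both sides vanish, since \<open>\<lceil>u\<rceil> = u\<close>.\<close>
        case 2
        hence "u \<in> A n" by (auto simp: A_def)
        thus ?thesis using 2 ceil[of u n] by (simp add: g_def I_def)
      next
        case 3
        hence "u \<notin> I" by (auto simp: I_def A_def)
        thus ?thesis using 3 by simp
      qed
    qed
    also have "\<dots> = ennreal (\<Phi> (real (Suc n)) - \<Phi> (real n) - \<phi> (real (Suc n)))"
      by (rule nn_integral_has_integral_lebesgue'[OF nn hi])
    finally show "(\<integral>\<^sup>+u. g u * indicator (A n) u \<partial>lborel) = ennreal (\<Phi> (real (Suc n)) - \<Phi> (real n) - \<phi> (real (Suc n)))" .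
    show "\<Phi> (real (Suc n)) - \<Phi> (real n) - \<phi> (real (Suc n)) \<ge> 0"
      by (rule has_integral_nonneg[OF hi nn])
  qed
  show "S \<ge> 0" by (rule sums_le[OF nonneg sums_zero sums])
  have "excess \<phi> = (\<integral>\<^sup>+u. g u * (\<Sum>n. indicator (A n) u) \<partial>lborel)"
    unfolding excess_def g_def suminf_indicator[OF disj] UN ..
  also have "\<dots> = (\<integral>\<^sup>+u. (\<Sum>n. g u * indicator (A n) u) \<partial>lborel)"
    by simp
  also have "\<dots> = (\<Sum>n. \<integral>\<^sup>+u. g u * indicator (A n) u \<partial>lborel)"
    by (rule nn_integral_suminf) (auto simp: A_def)
  also have "\<dots> = (\<Sum>n. ennreal (\<Phi> (real (Suc n)) - \<Phi> (real n) - \<phi> (real (Suc n))))"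
    by (simp only: int)
  also have "\<dots> = ennreal S"
    by (rule suminf_ennreal_eq[OF nonneg sums])
  finally show "excess \<phi> = ennreal S" .
qed

text \<open>
  The excess in \<open>u\<close> commutes with the Mellin transform in \<open>x\<close>. This is Tonelli's theorem.
\<close>

lemma mellin_excess:
  fixes K :: "real \<Rightarrow> real \<Rightarrow> real"
  assumes K [measurable]: "(\<lambda>(x, u). K x u) \<in> borel_measurable (borel \<Otimes>\<^sub>M borel)"
    and [measurable]: "\<psi> \<in> borel_measurable borel"
    and nonneg: "\<And>x u. 0 < x \<Longrightarrow> 0 < u \<Longrightarrow> 0 \<le> K x u"
    and mono: "\<And>x u v. 0 < x \<Longrightarrow> 0 < u \<Longrightarrow> u \<le> v \<Longrightarrow> K x v \<le> K x u"
    and mellin: "\<And>u. 0 < u \<Longrightarrow> (\<integral>\<^sup>+x\<in>{0<..}. ennreal (x powr (s - 1) * K x u) \<partial>lborel) = ennreal (C * \<psi> u)"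
    and C: "C \<ge> 0" and \<psi>: "\<And>u. \<psi> u \<ge> 0"
  shows "(\<integral>\<^sup>+x\<in>{0<..}. ennreal (x powr (s - 1)) * excess (K x) \<partial>lborel) = ennreal C * excess \<psi>"
proof -
  have [measurable]: "(\<lambda>(x, u::real). K x (real_of_int \<lceil>u\<rceil>)) \<in> borel_measurable (borel \<Otimes>\<^sub>M borel)"
  proof -
    have ceil: "(\<lambda>u::real. real_of_int \<lceil>u\<rceil>) \<in> borel \<rightarrow>\<^sub>M borel" by measurable
    have "(\<lambda>p::real \<times> real. (fst p, real_of_int \<lceil>snd p\<rceil>)) \<in> borel \<Otimes>\<^sub>M borel \<rightarrow>\<^sub>M borel \<Otimes>\<^sub>M borel"
      by (intro measurable_Pair measurable_fst measurable_compose[OF measurable_snd ceil])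
    from measurable_compose[OF this K] show ?thesis by (simp add: case_prod_unfold)
  qed
  have meas1 [measurable]: "(\<lambda>x. K x u) \<in> borel_measurable borel" for u
  proof -
    have "(\<lambda>x. (x, u)) \<in> borel \<rightarrow>\<^sub>M borel \<Otimes>\<^sub>M borel" by measurable
    from measurable_compose[OF this K] show ?thesis by simp
  qed
  have meas2 [measurable]: "(\<lambda>u. K x u) \<in> borel_measurable borel" for x
  proof -
    have "(\<lambda>u. (x, u)) \<in> borel \<rightarrow>\<^sub>M borel \<Otimes>\<^sub>M borel" by measurable
    from measurable_compose[OF this K] show ?thesis by simp
  qed
  define f where "f = (\<lambda>x u. ennreal (x powr (s - 1) * (K x u - K x (real_of_int \<lceil>u\<rceil>))) *
                         (indicator {0<..} x * indicator {0<..} u))"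
  have "(\<integral>\<^sup>+x\<in>{0<..}. ennreal (x powr (s - 1)) * excess (K x) \<partial>lborel) = (\<integral>\<^sup>+x. \<integral>\<^sup>+u. f x u \<partial>lborel \<partial>lborel)"
  proof (intro nn_integral_cong)
    fix x :: real
    have "ennreal (x powr (s - 1)) * excess (K x) * indicator {0<..} x =
      (\<integral>\<^sup>+u. (ennreal (x powr (s - 1)) * indicator {0<..} x) *
             (ennreal (K x u - K x (real_of_int \<lceil>u\<rceil>)) * indicator {0<..} u) \<partial>lborel)"
      unfolding excess_def by (subst nn_integral_cmult) (auto simp: mult_ac)
    also have "\<dots> = (\<integral>\<^sup>+u. f x u \<partial>lborel)"
      unfolding f_def by (intro nn_integral_cong) (simp add: ennreal_mult' mult_ac)
    finally show "ennreal (x powr (s - 1)) * excess (K x) * indicator {0<..} x = (\<integral>\<^sup>+u. f x u \<partial>lborel)" .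
  qed
  also have "\<dots> = (\<integral>\<^sup>+u. \<integral>\<^sup>+x. f x u \<partial>lborel \<partial>lborel)"
    by (rule lborel_pair.Fubini' [symmetric]) (simp add: f_def case_prod_unfold)
  also have "\<dots> = (\<integral>\<^sup>+u. ennreal C * (ennreal (\<psi> u - \<psi> (real_of_int \<lceil>u\<rceil>)) * indicator {0<..} u) \<partial>lborel)"
  proof (intro nn_integral_cong)
    fix u :: real
    show "(\<integral>\<^sup>+x. f x u \<partial>lborel) = ennreal C * (ennreal (\<psi> u - \<psi> (real_of_int \<lceil>u\<rceil>)) * indicator {0<..} u)"
    proof (cases "u > 0")
      case False
      thus ?thesis by (simp add: f_def)
    next
      case True
      define v where "v = real_of_int \<lceil>u\<rceil>"
      have v: "u \<le> v" "0 < v" using True by (auto simp: v_def)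
      have "(\<integral>\<^sup>+x. f x u \<partial>lborel) =
        (\<integral>\<^sup>+x. ennreal (x powr (s - 1) * K x u) * indicator {0<..} x -
               ennreal (x powr (s - 1) * K x v) * indicator {0<..} x \<partial>lborel)"
        using True nonneg v
        by (intro nn_integral_cong)
           (auto simp: f_def v_def [symmetric] indicator_def right_diff_distrib ennreal_minus)
      also have "\<dots> = (\<integral>\<^sup>+x\<in>{0<..}. ennreal (x powr (s - 1) * K x u) \<partial>lborel) -
                       (\<integral>\<^sup>+x\<in>{0<..}. ennreal (x powr (s - 1) * K x v) \<partial>lborel)"
        using v True mellin[OF v(2)]
        by (intro nn_integral_diff)
           (auto simp: indicator_def intro!: AE_I2 ennreal_leI mult_left_mono mono)
      also have "\<dots> = ennreal (C * \<psi> u) - ennreal (C * \<psi> v)"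
        using mellin True v by simp
      also have "\<dots> = ennreal C * ennreal (\<psi> u - \<psi> v)"
        using C \<psi> by (simp add: ennreal_minus ennreal_mult'[symmetric] right_diff_distrib)
      finally show ?thesis using True by (simp add: v_def)
    qed
  qed
  also have "\<dots> = ennreal C * excess \<psi>"
    unfolding excess_def by (rule nn_integral_cmult) measurable
  finally show ?thesis .
qed

lemma nn_integral_gamma_kernel:
  assumes "p > (0::real)" "a > 0"
  shows "(\<integral>\<^sup>+x\<in>{0<..}. ennreal (x powr (p - 1) * exp (-a * x)) \<partial>lborel) = ennreal (Gamma p * a powr (-p))"
proof -
  have "ennreal (Gamma p) = (\<integral>\<^sup>+t. ennreal (indicator {0..} t * t powr (p - 1) / exp t) \<partial>lborel)"
    by (rule Gamma_conv_nn_integral_real[OF assms(1)])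
  also have "\<dots> = ennreal \<bar>a\<bar> * (\<integral>\<^sup>+x. ennreal (indicator {0..} (0 + a * x) * (0 + a * x) powr (p - 1) / exp (0 + a * x)) \<partial>lborel)"
    using assms by (intro nn_integral_real_affine) auto
  also have "(\<integral>\<^sup>+x. ennreal (indicator {0..} (0 + a * x) * (0 + a * x) powr (p - 1) / exp (0 + a * x)) \<partial>lborel) =
     (\<integral>\<^sup>+x. ennreal (a powr (p - 1)) * (ennreal (x powr (p - 1) * exp (-a * x)) * indicator {0<..} x) \<partial>lborel)"
    using assms
    by (intro nn_integral_cong)
       (auto simp: indicator_def powr_mult exp_minus field_simps ennreal_mult'[symmetric] zero_le_mult_iff)
  also have "\<dots> = ennreal (a powr (p - 1)) * (\<integral>\<^sup>+x\<in>{0<..}. ennreal (x powr (p - 1) * exp (-a * x)) \<partial>lborel)"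
    by (rule nn_integral_cmult) measurable
  finally have eq: "ennreal (Gamma p) = ennreal (a powr p) * (\<integral>\<^sup>+x\<in>{0<..}. ennreal (x powr (p - 1) * exp (-a * x)) \<partial>lborel)"
    using assms by (simp add: mult.assoc [symmetric] ennreal_mult'[symmetric] powr_diff)
  have "ennreal (Gamma p * a powr (-p)) = ennreal (a powr (-p)) * ennreal (Gamma p)"
    using assms by (simp add: ennreal_mult'[symmetric] mult.commute)
  also have "\<dots> = (\<integral>\<^sup>+x\<in>{0<..}. ennreal (x powr (p - 1) * exp (-a * x)) \<partial>lborel)"
    unfolding eq mult.assoc [symmetric]
    using assms by (simp add: ennreal_mult'[symmetric] powr_add[symmetric])
  finally show ?thesis ..
qed

lemma nn_integral_substitution_square:
  assumes [measurable]: "f \<in> borel_measurable borel"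
  shows "(\<integral>\<^sup>+x\<in>{0..}. ennreal (f (x ^ 2) * (2 * x)) \<partial>lborel) = (\<integral>\<^sup>+y\<in>{0..}. ennreal (f y) \<partial>lborel)"
proof (rule LIMSEQ_unique)
  have lim: "(\<lambda>n. \<integral>\<^sup>+x. h x * indicator {0..c n} x \<partial>lborel) \<longlonglongrightarrow> (\<integral>\<^sup>+x\<in>{0..}. h x \<partial>lborel)"
    if [measurable]: "h \<in> borel_measurable borel" and c: "incseq c" "filterlim c at_top sequentially"
    for h :: "real \<Rightarrow> ennreal" and c :: "nat \<Rightarrow> real"
  proof (rule nn_integral_LIMSEQ)
    show "incseq (\<lambda>n x. h x * indicator {0..c n} x)"
      using c(1) by (auto simp: incseq_def le_fun_def indicator_def intro: order_trans)
    show "(\<lambda>n. h x * indicator {0..c n} x) \<longlonglongrightarrow> h x * indicator {0..} x" for x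
    proof (rule tendsto_eventually)
      have "eventually (\<lambda>n. x \<le> c n) sequentially" using c(2) by (simp add: filterlim_at_top)
      thus "\<forall>\<^sub>F n in sequentially. h x * indicator {0..c n} x = h x * indicator {0..} x"
        by eventually_elim (auto simp: indicator_def)
    qed
  qed measurable
  show "(\<lambda>n. \<integral>\<^sup>+x. ennreal (f (x ^ 2) * (2 * x)) * indicator {0..real n} x \<partial>lborel) \<longlonglongrightarrow> 
          (\<integral>\<^sup>+x\<in>{0..}. ennreal (f (x ^ 2) * (2 * x)) \<partial>lborel)"
    by (rule lim) (auto simp: incseq_def filterlim_real_sequentially)
  have "(\<lambda>n. \<integral>\<^sup>+x. ennreal (f x) * indicator {0..(real n)\<^sup>2} x \<partial>lborel) \<longlonglongrightarrow> (\<integral>\<^sup>+y\<in>{0..}. ennreal (f y) \<partial>lborel)"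
    by (rule lim) (auto simp: incseq_def power_mono intro!: filterlim_pow_at_top filterlim_real_sequentially)
  also have "(\<lambda>n. \<integral>\<^sup>+x. ennreal (f x) * indicator {0..(real n)\<^sup>2} x \<partial>lborel) =
             (\<lambda>n. \<integral>\<^sup>+x. ennreal (f (x ^ 2) * (2 * x)) * indicator {0..real n} x \<partial>lborel)"
  proof
    fix n :: nat
    have "(\<integral>\<^sup>+x. ennreal (f x * indicator {0\<^sup>2..(real n)\<^sup>2} x) \<partial>lborel) =
          (\<integral>\<^sup>+x. ennreal (f (x ^ 2) * (2 * x) * indicator {0..real n} x) \<partial>lborel)"
      by (rule nn_integral_substitution)
         (auto intro!: derivative_eq_intros continuous_intros simp: set_borel_measurable_def)
    thus "(\<integral>\<^sup>+x. ennreal (f x) * indicator {0..(real n)\<^sup>2} x \<partial>lborel) =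
          (\<integral>\<^sup>+x. ennreal (f (x ^ 2) * (2 * x)) * indicator {0..real n} x \<partial>lborel)"
      by (simp add: ennreal_mult'' ennreal_indicator)
  qed
  finally show "(\<lambda>n. \<integral>\<^sup>+x. ennreal (f (x ^ 2) * (2 * x)) * indicator {0..real n} x \<partial>lborel) \<longlonglongrightarrow>
                  (\<integral>\<^sup>+y\<in>{0..}. ennreal (f y) \<partial>lborel)" .
qed

text \<open>
  The Gamma integral after the substitution \<open>y = x\<^sup>2\<close>.
\<close>

lemma nn_integral_gaussian_kernel:
  assumes "p > (0::real)" "t > 0"
  shows "(\<integral>\<^sup>+x\<in>{0<..}. ennreal (2 * x powr (2 * p - 1) * exp (-t * x ^ 2)) \<partial>lborel) = ennreal (Gamma p * t powr (-p))"
proof -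
  have "(\<integral>\<^sup>+x\<in>{0<..}. ennreal (2 * x powr (2 * p - 1) * exp (-t * x ^ 2)) \<partial>lborel) =
        (\<integral>\<^sup>+x\<in>{0..}. ennreal ((x ^ 2) powr (p - 1) * exp (-t * x ^ 2) * (2 * x)) \<partial>lborel)"
  proof (intro nn_integral_cong)
    fix x :: real
    show "ennreal (2 * x powr (2 * p - 1) * exp (-t * x ^ 2)) * indicator {0<..} x =
          ennreal ((x ^ 2) powr (p - 1) * exp (-t * x ^ 2) * (2 * x)) * indicator {0..} x"
    proof (cases "x > 0")
      case True
      have "x powr (2 * p - 1) = x powr (2 * (p - 1)) * x powr 1"
        by (subst powr_add [symmetric]) (simp add: algebra_simps)
      also have "x powr (2 * (p - 1)) = (x ^ 2) powr (p - 1)"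
        using True by (subst powr_powr [symmetric]) (simp add: powr_numeral)
      finally show ?thesis using True by (simp add: mult_ac)
    qed (auto simp: indicator_def)
  qed
  also have "\<dots> = (\<integral>\<^sup>+y\<in>{0..}. ennreal (y powr (p - 1) * exp (-t * y)) \<partial>lborel)"
    by (rule nn_integral_substitution_square) measurable
  also have "\<dots> = (\<integral>\<^sup>+y\<in>{0<..}. ennreal (y powr (p - 1) * exp (-t * y)) \<partial>lborel)"
    by (intro nn_integral_cong) (auto simp: indicator_def)
  also have "\<dots> = ennreal (Gamma p * t powr (-p))"
    using assms by (rule nn_integral_gamma_kernel)
  finally show ?thesis .
qed

text \<open>
  Writing \<open>1 / (x\<^sup>2 + a\<^sup>2)\<close> as the integral of \<open>exp (-t (x\<^sup>2 + a\<^sup>2))\<close> over \<open>t > 0\<close> and exchanging the integrals leaves a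
  Gaussian integral in \<open>x\<close> followed by a Gamma integral in \<open>t\<close>.
\<close>

lemma mellin_cauchy_kernel:
  assumes "0 < (s::real)" "s < 1" "a > 0"
  shows "(\<integral>\<^sup>+x\<in>{0<..}. ennreal (x powr (s - 1) * (2 * x / (x\<^sup>2 + a\<^sup>2))) \<partial>lborel) =
           ennreal (Gamma ((1 + s) / 2) * Gamma ((1 - s) / 2) * a powr (s - 1))"
proof -
  define f where "f = (\<lambda>x t. ennreal (2 * x powr s * exp (-t * x ^ 2)) * indicator {0<..} x *
                               (ennreal (exp (-t * a\<^sup>2)) * indicator {0<..} t))"
  have "(\<integral>\<^sup>+x\<in>{0<..}. ennreal (x powr (s - 1) * (2 * x / (x\<^sup>2 + a\<^sup>2))) \<partial>lborel) = (\<integral>\<^sup>+x. \<integral>\<^sup>+t. f x t \<partial>lborel \<partial>lborel)"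
  proof (intro nn_integral_cong)
    fix x :: real
    show "ennreal (x powr (s - 1) * (2 * x / (x\<^sup>2 + a\<^sup>2))) * indicator {0<..} x = (\<integral>\<^sup>+t. f x t \<partial>lborel)"
    proof (cases "x > 0")
      case True
      define b where "b = x\<^sup>2 + a\<^sup>2"
      have b: "b > 0" using assms True by (simp add: b_def add_pos_pos)
      have "(\<integral>\<^sup>+t. f x t \<partial>lborel) =
              (\<integral>\<^sup>+t. ennreal (2 * x powr s) * (ennreal (t powr (1 - 1) * exp (-b * t)) * indicator {0<..} t) \<partial>lborel)"
        unfolding f_def using True
        by (intro nn_integral_cong)
           (auto simp: indicator_def ennreal_mult'[symmetric] b_def exp_add[symmetric] algebra_simps mult_exp_exp)
      also have "\<dots> = ennreal (2 * x powr s) * (\<integral>\<^sup>+t\<in>{0<..}. ennreal (t powr (1 - 1) * exp (-b * t)) \<partial>lborel)"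
        by (rule nn_integral_cmult) measurable
      also have "\<dots> = ennreal (2 * x powr s) * ennreal (Gamma 1 * b powr (-1))"
        using b by (subst nn_integral_gamma_kernel) auto
      also have "\<dots> = ennreal (x powr (s - 1) * (2 * x / b))"
        using b True by (simp add: ennreal_mult'[symmetric] powr_minus powr_diff field_simps)
      finally show ?thesis using True by (simp add: b_def)
    qed (simp add: f_def)
  qed
  also have "\<dots> = (\<integral>\<^sup>+t. \<integral>\<^sup>+x. f x t \<partial>lborel \<partial>lborel)"
    by (rule lborel_pair.Fubini' [symmetric]) (simp add: f_def case_prod_unfold)
  also have "\<dots> = (\<integral>\<^sup>+t. ennreal (Gamma ((1 + s) / 2)) *
                    (ennreal (t powr ((1 - s) / 2 - 1) * exp (-a\<^sup>2 * t)) * indicator {0<..} t) \<partial>lborel)"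
  proof (intro nn_integral_cong)
    fix t :: real
    show "(\<integral>\<^sup>+x. f x t \<partial>lborel) = ennreal (Gamma ((1 + s) / 2)) *
            (ennreal (t powr ((1 - s) / 2 - 1) * exp (-a\<^sup>2 * t)) * indicator {0<..} t)"
    proof (cases "t > 0")
      case True
      have e: "2 * ((1 + s) / 2) - 1 = s" by (simp add: field_simps)
      have "(\<integral>\<^sup>+x. f x t \<partial>lborel) =
              (\<integral>\<^sup>+x\<in>{0<..}. ennreal (2 * x powr (2 * ((1 + s) / 2) - 1) * exp (-t * x ^ 2)) \<partial>lborel) * ennreal (exp (-t * a\<^sup>2))"
        unfolding f_def e using True by (subst nn_integral_multc [symmetric]) auto
      also have "\<dots> = ennreal (Gamma ((1 + s) / 2) * t powr (-((1 + s) / 2))) * ennreal (exp (-t * a\<^sup>2))"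
        using assms True by (subst nn_integral_gaussian_kernel) auto
      also have "-((1 + s) / 2) = (1 - s) / 2 - 1" by (simp add: field_simps)
      finally show ?thesis using True assms
        by (simp add: ennreal_mult'[symmetric] mult_ac)
    qed (simp add: f_def)
  qed
  also have "\<dots> = ennreal (Gamma ((1 + s) / 2)) *
                    (\<integral>\<^sup>+t\<in>{0<..}. ennreal (t powr ((1 - s) / 2 - 1) * exp (-a\<^sup>2 * t)) \<partial>lborel)"
    by (rule nn_integral_cmult) measurable
  also have "\<dots> = ennreal (Gamma ((1 + s) / 2)) * ennreal (Gamma ((1 - s) / 2) * (a\<^sup>2) powr (-((1 - s) / 2)))"
    using assms by (subst nn_integral_gamma_kernel) auto
  also have "(a\<^sup>2) powr (-((1 - s) / 2)) = a powr (s - 1)"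
  proof -
    have "a\<^sup>2 = a powr 2" using assms by (simp add: powr_numeral)
    moreover have "2 * (-((1 - s) / 2)) = s - 1" by (simp add: field_simps)
    ultimately show ?thesis by (simp only: powr_powr)
  qed
  finally show ?thesis using assms by (simp add: ennreal_mult'[symmetric] mult_ac)
qed

text \<open>
  Inside the critical strip \<open>\<Sum> n powr (-s)\<close> and \<open>\<integral> u powr (-s) du\<close> both diverge, but the excess of the
  integral over the sum is finite and equals \<open>-\<zeta>(s)\<close>.
\<close>

lemma excess_powr:
  assumes "0 < (s::real)" "s < 1"
  defines "Z \<equiv> (\<Sum>n. real (Suc n) powr (1 - s) - real n powr (1 - s) - (1 - s) * real (Suc n) powr (-s)) / (1 - s)"
  shows "excess (\<lambda>u. u powr (-s)) = ennreal Z" "Z \<ge> 0"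
    "zeta_reg (of_real s) = of_real ((1 - s) * Z)"
proof -
  define a where "a = (\<lambda>n. real (Suc n) powr (1 - s) - real n powr (1 - s) - (1 - s) * real (Suc n) powr (-s))"
  have term_eq: "zeta_reg_term n (of_real s) = of_real (a n)" for n
  proof -
    have "of_nat m powr (1 - complex_of_real s) = of_real (real m powr (1 - s))"
          "of_nat m powr (- complex_of_real s) = of_real (real m powr (- s))" for m
      using powr_of_real[of "real m" "1 - s"] powr_of_real[of "real m" "-s"] by simp_all
    thus ?thesis by (simp add: zeta_reg_term_def a_def algebra_simps del: of_nat_Suc)
  qed
  have csums: "(\<lambda>n. complex_of_real (a n)) sums zeta_reg (of_real s)"
    using zeta_reg_term_sums[of "of_real s"] assms by (simp add: term_eq)
  from sums_Re[OF this] have "a sums Re (zeta_reg (of_real s))" by simp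
  hence a: "a sums (\<Sum>n. a n)" by (simp add: sums_iff)
  have Z: "Z = (\<Sum>n. a n) / (1 - s)" unfolding Z_def a_def ..
  have "(\<lambda>n. complex_of_real (a n)) sums of_real (\<Sum>n. a n)" using a by (rule sums_of_real)
  with csums have "zeta_reg (of_real s) = of_real (\<Sum>n. a n)" by (rule sums_unique2)
  thus "zeta_reg (of_real s) = of_real ((1 - s) * Z)" unfolding Z using assms by simp
  define \<Phi> where "\<Phi> = (\<lambda>u::real. u powr (1 - s) / (1 - s))"
  have sums: "(\<lambda>n. \<Phi> (real (Suc n)) - \<Phi> (real n) - real (Suc n) powr (-s)) sums Z"
    using sums_divide[OF a, of "1 - s"] assms unfolding Z a_def \<Phi>_def by (simp add: diff_divide_distrib)
  have cont: "continuous_on {0..} \<Phi>"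
    unfolding \<Phi>_def using assms by (intro continuous_intros continuous_on_powr') auto
  have deriv: "(\<Phi> has_real_derivative u powr (-s)) (at u)" if "u > 0" for u
    unfolding \<Phi>_def using that assms by (auto intro!: derivative_eq_intros)
  have mono: "v powr (-s) \<le> u powr (-s)" if "0 < u" "u \<le> v" for u v :: real
    using that assms by (intro powr_mono2') auto
  show "excess (\<lambda>u. u powr (-s)) = ennreal Z" "Z \<ge> 0"
    using excess_eq_suminf[OF _ mono cont deriv sums] by simp_all
qed

lemma excess_exp:
  assumes "(x::real) > 0"
  shows "excess (\<lambda>u. exp (-u * x)) = ennreal (1 / x - 1 / (exp x - 1))"
proof (rule excess_eq_suminf(1))
  show "continuous_on {0..} (\<lambda>u. - exp (-u * x) / x)"
    using assms by (intro continuous_intros) auto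
  show "((\<lambda>u. - exp (-u * x) / x) has_real_derivative exp (-u * x)) (at u)" for u
    using assms by (auto intro!: derivative_eq_intros)
  have "(\<lambda>n. exp (-x) ^ Suc n) sums (exp (-x) * (1 / (1 - exp (-x))))"
    unfolding power_Suc using assms by (intro sums_mult geometric_sums) simp
  hence geo: "(\<lambda>n. exp (- real (Suc n) * x)) sums (1 / (exp x - 1))"
    using assms by (simp add: exp_of_nat_mult[symmetric] exp_minus field_simps del: of_nat_Suc power_Suc)
  have "(\<lambda>n. exp (- real n * x)) \<longlonglongrightarrow> 0"
    using LIMSEQ_power_zero[of "exp (-x)"] assms by (simp add: exp_of_nat_mult[symmetric])
  hence "(\<lambda>n. - exp (- real n * x) / x) \<longlonglongrightarrow> - 0 / x"
    by (intro tendsto_intros) (use assms in auto)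
  from telescope_sums[OF this]
  have "(\<lambda>n. - exp (- real (Suc n) * x) / x - - exp (- real n * x) / x) sums (1 / x)" by simp
  from sums_diff[OF this geo]
  show "(\<lambda>n. - exp (- real (Suc n) * x) / x - - exp (- real n * x) / x - exp (- real (Suc n) * x))
          sums (1 / x - 1 / (exp x - 1))" .
qed (use assms in \<open>auto simp: mult_right_mono\<close>)

text \<open>
  The logarithmic derivative of the reflection formula for Gamma.
\<close>

lemma sin_times_Digamma_reflection:
  fixes z :: complex
  assumes "z \<notin> \<int>"
  shows "sin (of_real pi * z) * (Digamma (1 - z) - Digamma z) = of_real pi * cos (of_real pi * z)"
proof -
  have z: "z \<notin> \<int>\<^sub>\<le>\<^sub>0" "1 - z \<notin> \<int>\<^sub>\<le>\<^sub>0"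
    using assms by (auto dest: nonpos_Ints_Int)
  have "((\<lambda>z. rGamma z * rGamma (1 - z)) has_field_derivative
           (- rGamma z * Digamma z * rGamma (1 - z) + rGamma z * (rGamma (1 - z) * Digamma (1 - z)))) (at z)"
    using z by (auto intro!: derivative_eq_intros DERIV_chain2[OF has_field_derivative_rGamma_no_nonpos_int])
  moreover have "((\<lambda>z. rGamma z * rGamma (1 - z)) has_field_derivative cos (of_real pi * z)) (at z)"
    unfolding rGamma_reflection_complex by (auto intro!: derivative_eq_intros)
  ultimately have "cos (of_real pi * z) = - rGamma z * Digamma z * rGamma (1 - z) + rGamma z * (rGamma (1 - z) * Digamma (1 - z))"
    by (rule DERIV_unique[rotated])
  also have "\<dots> = (rGamma z * rGamma (1 - z)) * (Digamma (1 - z) - Digamma z)"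
    by (simp add: algebra_simps)
  also have "\<dots> = sin (of_real pi * z) / of_real pi * (Digamma (1 - z) - Digamma z)"
    by (simp only: rGamma_reflection_complex)
  finally show ?thesis by (simp add: field_simps)
qed

text \<open>
  The partial fraction expansion of \<open>coth (x / 2)\<close>. It is the reflection formula of the Digamma function at
  \<open>z = ix / (2\<pi>)\<close>, where the two Digamma series combine to the left hand side and \<open>\<pi> cot (\<pi> z)\<close> becomes a
  hyperbolic cotangent.
\<close>

lemma cauchy_kernel_sums:
  assumes "(x::real) > 0"
  shows "(\<lambda>n. 2 * x / (x\<^sup>2 + (2 * pi * real (Suc n))\<^sup>2)) sums (1 / (exp x - 1) + 1 / 2 - 1 / x)"
proof -
  define z where "z = \<i> * of_real (x / (2 * pi))"
  have z: "Re z = 0" "Im z \<noteq> 0" using assms by (auto simp: z_def)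
  hence nz: "z \<noteq> 0" and zint: "z \<notin> \<int>" by (auto elim!: Ints_cases)
  have dig: "(\<lambda>n. inverse (of_nat (Suc n)) - inverse (w + of_nat n)) sums (Digamma w + euler_mascheroni)"
    if "w \<noteq> 0" for w :: complex
    using summable_sums[OF summable_Digamma[OF that]] by (simp add: Digamma_def)
  have nz': "1 + z \<noteq> 0" "1 - z \<noteq> 0" using z by (auto simp: complex_eq_iff)
  have "(\<lambda>n. (inverse (of_nat (Suc n)) - inverse (1 - z + of_nat n)) - (inverse (of_nat (Suc n)) - inverse (1 + z + of_nat n)))
         sums ((Digamma (1 - z) + euler_mascheroni) - (Digamma (1 + z) + euler_mascheroni))"
    by (intro sums_diff dig nz')
  moreover have "(inverse (of_nat (Suc n)) - inverse (1 - z + of_nat n)) - (inverse (of_nat (Suc n)) - inverse (1 + z + of_nat n))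
      = - \<i> * of_real pi * of_real (2 * (2 * x / (x\<^sup>2 + (2 * pi * real (Suc n))\<^sup>2)))" for n
  proof -
    define m where "m = complex_of_real (real (Suc n))"
    define y where "y = complex_of_real x"
    define q where "q = complex_of_real pi"
    have m: "1 - z + of_nat n = m - z" "1 + z + of_nat n = m + z" by (simp_all add: m_def)
    have zz: "z = \<i> * y / (2 * q)" by (simp add: z_def y_def q_def)
    have "m + z \<noteq> 0" "m - z \<noteq> 0" using z by (auto simp: complex_eq_iff m_def)
    hence "inverse (m + z) - inverse (m - z) = - 2 * z / (m\<^sup>2 - z\<^sup>2)"
      by (simp add: field_simps power2_eq_square)
    also have "\<dots> = - \<i> * q * (2 * (2 * y / (y\<^sup>2 + (2 * q * m)\<^sup>2)))"
    proof -
      have "q \<noteq> 0" by (simp add: q_def)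
      have "m\<^sup>2 - z\<^sup>2 = (y\<^sup>2 + (2 * q * m)\<^sup>2) / (4 * q\<^sup>2)"
        using \<open>q \<noteq> 0\<close> by (simp add: zz field_simps power2_eq_square)
      thus ?thesis using \<open>q \<noteq> 0\<close> by (simp add: zz power2_eq_square)
    qed
    finally show ?thesis unfolding m by (simp add: y_def q_def m_def)
  qed
  ultimately have sums1: "(\<lambda>n. - \<i> * of_real pi * of_real (2 * (2 * x / (x\<^sup>2 + (2 * pi * real (Suc n))\<^sup>2))))
                     sums (Digamma (1 - z) - Digamma (1 + z))" by simp
  have sin: "sin (of_real pi * z) = \<i> * of_real ((exp (x/2) - exp (-(x/2))) / 2)"
   and cos: "cos (of_real pi * z) = of_real ((exp (x/2) + exp (-(x/2))) / 2)"
  proof -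
    have pz: "of_real pi * z = \<i> * of_real (x / 2)" by (simp add: z_def)
    show "sin (of_real pi * z) = \<i> * of_real ((exp (x/2) - exp (-(x/2))) / 2)"
      unfolding pz sin_exp_eq by (simp add: exp_of_real[symmetric] field_simps)
    show "cos (of_real pi * z) = of_real ((exp (x/2) + exp (-(x/2))) / 2)"
      unfolding pz cos_exp_eq by (simp add: exp_of_real[symmetric] field_simps)
  qed
  define d where "d = exp x - 1"
  have "d > 0" using assms by (simp add: d_def)
  have "sin (of_real pi * z) \<noteq> 0" using assms by (simp add: sin)
  have frac: "(exp (x/2) + exp (-(x/2))) / (exp (x/2) - exp (-(x/2))) = 1 + 2 / (exp x - 1)"
  proof -
    define r where "r = exp (x / 2)"
    have r: "r > 1" using assms by (simp add: r_def)
    hence "r * r > 1" using mult_strict_mono[of 1 r 1 r] by simp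
    have e1: "exp x = r * r" unfolding r_def by (simp add: exp_add[symmetric])
    have e2: "exp (-(x/2)) = 1 / r" by (simp add: r_def exp_minus inverse_eq_divide)
    have "(r + 1 / r) / (r - 1 / r) = 1 + 2 / (r * r - 1)" using r \<open>r * r > 1\<close> by (simp add: field_simps)
    thus ?thesis unfolding r_def[symmetric] e1 e2 .
  qed
  have "Digamma (1 - z) - Digamma (1 + z) = (Digamma (1 - z) - Digamma z) - 1 / z"
    using Digamma_plus1[OF nz] by (simp add: add.commute)
  also have "Digamma (1 - z) - Digamma z = of_real pi * cos (of_real pi * z) / sin (of_real pi * z)"
    using sin_times_Digamma_reflection[OF zint] \<open>sin (of_real pi * z) \<noteq> 0\<close> by (simp add: field_simps)
  also have "\<dots> = - \<i> * of_real pi * of_real ((exp (x/2) + exp (-(x/2))) / (exp (x/2) - exp (-(x/2))))"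
  proof -
    have "p * a / (\<i> * b) = - \<i> * p * (a / b)" for p a b :: complex
      by (cases "b = 0") (simp_all add: field_simps)
    thus ?thesis unfolding sin cos by simp
  qed
  also have "\<dots> = - \<i> * of_real pi * of_real (1 + 2 / (exp x - 1))"
    by (simp only: frac)
  also have "\<dots> - 1 / z = - \<i> * of_real pi * of_real (1 + 2 / (exp x - 1) - 2 / x)"
    using assms by (simp add: z_def field_simps)
  finally have "Digamma (1 - z) - Digamma (1 + z) = - \<i> * of_real pi * of_real (1 + 2 / (exp x - 1) - 2 / x)" .
  with sums1 have "(\<lambda>n. (- \<i> * of_real pi) * of_real (2 * (2 * x / (x\<^sup>2 + (2 * pi * real (Suc n))\<^sup>2))))
                     sums ((- \<i> * of_real pi) * of_real (1 + 2 / (exp x - 1) - 2 / x))" by simp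
  hence "(\<lambda>n. complex_of_real (2 * (2 * x / (x\<^sup>2 + (2 * pi * real (Suc n))\<^sup>2)))) sums of_real (1 + 2 / (exp x - 1) - 2 / x)"
    by (subst (asm) sums_mult_iff) auto
  hence "(\<lambda>n. 2 * (2 * x / (x\<^sup>2 + (2 * pi * real (Suc n))\<^sup>2))) sums (1 + 2 / (exp x - 1) - 2 / x)"
    by (simp only: sums_of_real_iff)
  from sums_mult[OF this, of "1 / 2"] show ?thesis by (simp add: algebra_simps)
qed

text \<open>
  The same value as for the exponential kernel: the integral of the kernel is \<open>1 / 2\<close> and its sum is
  \<open>1 / (exp x - 1) + 1 / 2 - 1 / x\<close>. (The two kernels are a cosine transform pair, so this agreement is a case of
  Poisson summation.)
\<close>

lemma excess_cauchy:
  assumes "(x::real) > 0"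
  shows "excess (\<lambda>u. 2 * x / (x\<^sup>2 + (2 * pi * u)\<^sup>2)) = ennreal (1 / x - 1 / (exp x - 1))"
proof (rule excess_eq_suminf(1))
  have den: "x\<^sup>2 + (2 * pi * u)\<^sup>2 > 0" for u using assms by (simp add: add_pos_nonneg)
  show "(\<lambda>u. 2 * x / (x\<^sup>2 + (2 * pi * u)\<^sup>2)) \<in> borel_measurable borel" by measurable
  show "2 * x / (x\<^sup>2 + (2 * pi * v)\<^sup>2) \<le> 2 * x / (x\<^sup>2 + (2 * pi * u)\<^sup>2)" if "0 < u" "u \<le> v" for u v
    using that assms den by (intro divide_left_mono add_mono power_mono mult_pos_pos) auto
  show "continuous_on {0..} (\<lambda>u. arctan (2 * pi * u / x) / pi)"
    using assms by (intro continuous_intros) auto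
  show "((\<lambda>u. arctan (2 * pi * u / x) / pi) has_real_derivative 2 * x / (x\<^sup>2 + (2 * pi * u)\<^sup>2)) (at u)" for u
  proof -
    have "((\<lambda>u. arctan (2 * pi * u / x) / pi) has_real_derivative
            (inverse (1 + (2 * pi * u / x)\<^sup>2) * (2 * pi / x)) / pi) (at u)"
      by (intro derivative_eq_intros refl) (use assms in auto)
    also have "1 + (2 * pi * u / x)\<^sup>2 = (x\<^sup>2 + (2 * pi * u)\<^sup>2) / x\<^sup>2"
      using assms by (simp add: power_divide add_divide_distrib)
    also have "inverse ((x\<^sup>2 + (2 * pi * u)\<^sup>2) / x\<^sup>2) * (2 * pi / x) / pi = 2 * x / (x\<^sup>2 + (2 * pi * u)\<^sup>2)"
      using assms by (simp add: power2_eq_square)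
    finally show ?thesis .
  qed
  have "filterlim (\<lambda>n. 2 * pi * real n / x) at_top sequentially"
    using assms by real_asymp
  hence "(\<lambda>n. arctan (2 * pi * real n / x)) \<longlonglongrightarrow> pi / 2"
    by (rule filterlim_compose[OF tendsto_arctan_at_top])
  hence "(\<lambda>n. arctan (2 * pi * real n / x) / pi) \<longlonglongrightarrow> (pi / 2) / pi"
    by (intro tendsto_intros) auto
  from telescope_sums[OF this]
  have "(\<lambda>n. arctan (2 * pi * real (Suc n) / x) / pi - arctan (2 * pi * real n / x) / pi) sums (1 / 2)" by simp
  from sums_diff[OF this cauchy_kernel_sums[OF assms]]
  show "(\<lambda>n. arctan (2 * pi * real (Suc n) / x) / pi - arctan (2 * pi * real n / x) / pi -
              2 * x / (x\<^sup>2 + (2 * pi * real (Suc n))\<^sup>2)) sums (1 / x - 1 / (exp x - 1))"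
    by (simp add: algebra_simps)
qed

text \<open>
  The Mellin transform of \<open>1 / x - 1 / (exp x - 1)\<close> is computed twice, with this function written as the excess of
  the exponential kernel and as the excess of the Cauchy kernel. The first one produces the excess of
  \<open>u powr (-s)\<close>, the second one the excess of \<open>u powr (-(1 - s))\<close>, that is, the values of zeta at \<open>s\<close> and \<open>1 - s\<close>.
\<close>

lemma zeta_reg_functional_equation_real:
  assumes "0 < (s::real)" "s < 1"
  shows "of_real (s * Gamma s) * zeta_reg (of_real s) =
         of_real ((1 - s) * (2 * pi) powr (s - 1) * Gamma ((1 + s) / 2) * Gamma ((1 - s) / 2)) * zeta_reg (of_real (1 - s))"
proof -
  have s': "0 < 1 - s" "1 - s < 1" using assms by auto
  obtain Z Z' where Z: "excess (\<lambda>u. u powr (-s)) = ennreal Z" "Z \<ge> 0" "zeta_reg (of_real s) = of_real ((1 - s) * Z)"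
    and Z': "excess (\<lambda>u. u powr (-(1 - s))) = ennreal Z'" "Z' \<ge> 0" "zeta_reg (of_real (1 - s)) = of_real (s * Z')"
    using excess_powr[OF assms] excess_powr[OF s'] by auto
  define C where "C = (2 * pi) powr (s - 1) * Gamma ((1 + s) / 2) * Gamma ((1 - s) / 2)"
  have G: "Gamma s > 0" "C \<ge> 0" using assms by (auto simp: C_def intro!: less_imp_le mult_pos_pos Gamma_real_pos)
  have "ennreal (Gamma s) * excess (\<lambda>u. u powr (-s)) =
          (\<integral>\<^sup>+x\<in>{0<..}. ennreal (x powr (s - 1)) * excess (\<lambda>u. exp (-u * x)) \<partial>lborel)"
  proof (rule mellin_excess [symmetric])
    show "(\<integral>\<^sup>+x\<in>{0<..}. ennreal (x powr (s - 1) * exp (-u * x)) \<partial>lborel) = ennreal (Gamma s * u powr (-s))" if "u > 0" for u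
      using that assms by (intro nn_integral_gamma_kernel)
  qed (use G in \<open>auto simp: mult_right_mono\<close>)
  also have "\<dots> = (\<integral>\<^sup>+x\<in>{0<..}. ennreal (x powr (s - 1)) * excess (\<lambda>u. 2 * x / (x\<^sup>2 + (2 * pi * u)\<^sup>2)) \<partial>lborel)"
  proof (intro nn_integral_cong)
    fix x :: real
    show "ennreal (x powr (s - 1)) * excess (\<lambda>u. exp (-u * x)) * indicator {0<..} x =
            ennreal (x powr (s - 1)) * excess (\<lambda>u. 2 * x / (x\<^sup>2 + (2 * pi * u)\<^sup>2)) * indicator {0<..} x"
    proof (cases "x > 0")
      case True
      show ?thesis unfolding excess_exp[OF True] excess_cauchy[OF True] ..
    qed simp
  qed
  also have "\<dots> = ennreal C * excess (\<lambda>u. u powr (-(1 - s)))"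
  proof (rule mellin_excess)
    fix u :: real assume u: "u > 0"
    show "(\<integral>\<^sup>+x\<in>{0<..}. ennreal (x powr (s - 1) * (2 * x / (x\<^sup>2 + (2 * pi * u)\<^sup>2))) \<partial>lborel) = ennreal (C * u powr (-(1 - s)))"
      using mellin_cauchy_kernel[OF assms, of "2 * pi * u"] u by (simp add: C_def powr_mult mult_ac)
  next
    fix x u v :: real assume "0 < x" "0 < u" "u \<le> v"
    thus "2 * x / (x\<^sup>2 + (2 * pi * v)\<^sup>2) \<le> 2 * x / (x\<^sup>2 + (2 * pi * u)\<^sup>2)"
      by (intro divide_left_mono add_mono power_mono mult_pos_pos add_pos_nonneg) auto
  qed (use G in auto)
  finally have "ennreal (Gamma s * Z) = ennreal (C * Z')"
    unfolding Z Z' using G Z Z' by (simp add: ennreal_mult')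
  hence eq: "Gamma s * Z = C * Z'" using G Z Z' by simp
  have "s * Gamma s * ((1 - s) * Z) = s * (1 - s) * (Gamma s * Z)" by (simp add: mult_ac)
  also have "\<dots> = (1 - s) * C * (s * Z')" unfolding eq by (simp add: mult_ac)
  finally show ?thesis unfolding Z(3) Z'(3) C_def by (simp add: mult_ac flip: of_real_mult)
qed

section \<open>Functional equation and analytic continuation\<close>

lemma not_nonpos_Int_Re_pos: "Re z > 0 \<Longrightarrow> z \<notin> \<int>\<^sub>\<le>\<^sub>0"
  by (auto elim!: nonpos_Ints_cases)

lemma holomorphic_zeta_reg_reflect: "(\<lambda>s. zeta_reg (1 - s)) holomorphic_on {s. Re s < 1}"
proof -
  have "(zeta_reg \<circ> (\<lambda>s. 1 - s)) holomorphic_on {s. Re s < 1}"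
    by (rule holomorphic_on_compose_gen[OF _ holomorphic_zeta_reg]) (auto intro!: holomorphic_intros)
  thus ?thesis by (simp add: o_def)
qed

text \<open>
  Both sides are holomorphic in the critical strip and agree on its real points.
\<close>

lemma zeta_reg_functional_equation:
  assumes "0 < Re s" "Re s < 1"
  shows "s * Gamma s * zeta_reg s =
         (1 - s) * of_real (2 * pi) powr (s - 1) * Gamma ((1 + s) / 2) * Gamma ((1 - s) / 2) * zeta_reg (1 - s)"
    (is "?f s = ?g s")
proof -
  define S where "S = {s. 0 < Re s \<and> Re s < 1}"
  have S_eq: "S = {s. Re s > 0} \<inter> {s. Re s < 1}" by (auto simp: S_def)
  have "open S" unfolding S_eq by (intro open_Int open_halfspace_Re_gt open_halfspace_Re_lt)
  have "convex S" unfolding S_eq by (intro convex_Int convex_halfspace_Re_gt convex_halfspace_Re_lt)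
  have hol_refl: "(\<lambda>s. zeta_reg (1 - s)) holomorphic_on S"
    by (rule holomorphic_on_subset[OF holomorphic_zeta_reg_reflect]) (auto simp: S_def)
  have hol: "(\<lambda>s. ?f s - ?g s) holomorphic_on S"
    by (intro holomorphic_intros hol_refl holomorphic_on_subset[OF holomorphic_zeta_reg])
       (auto simp: S_def intro!: not_nonpos_Int_Re_pos)
  have lim: "(1 / 2) islimpt (complex_of_real ` {0<..<1})"
  proof -
    have mid: "(1 / 2 :: real) islimpt {0<..<1}"
      by (rule open_imp_islimpt) auto
    have ev: "eventually (\<lambda>y. complex_of_real y \<noteq> of_real x) (at x)" for x
      by (simp add: eventually_at_filter)
    have "of_real (1 / 2) islimpt (complex_of_real ` {0<..<1})"
      by (rule islimpt_isCont_image[OF mid _ ev]) simp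
    thus ?thesis by simp
  qed
  have "?f s - ?g s = 0"
  proof (rule analytic_continuation[OF hol \<open>open S\<close> convex_connected[OF \<open>convex S\<close>] _ _ lim])
    fix z assume "z \<in> complex_of_real ` {0<..<1}"
    then obtain x where x: "z = of_real x" "0 < x" "x < 1" by auto
    have "complex_of_real (2 * pi) powr (of_real x - 1) = of_real ((2 * pi) powr (x - 1))"
      using powr_of_real[of "2 * pi" "x - 1"] by simp
    moreover have "Gamma ((1 + complex_of_real x) / 2) = of_real (Gamma ((1 + x) / 2))"
                  "Gamma ((1 - complex_of_real x) / 2) = of_real (Gamma ((1 - x) / 2))"
                  "Gamma (complex_of_real x) = of_real (Gamma x)"
      by (simp_all flip: Gamma_complex_of_real)
    ultimately show "?f z - ?g z = 0"
      using zeta_reg_functional_equation_real[OF x(2,3)] by (simp add: x(1) del: of_real_mult) simp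
  qed (use assms in \<open>auto simp: S_def\<close>)
  thus ?thesis by simp
qed

lemma zeta_reg_zero_reflect:
  assumes "0 < Re s" "Re s < 1" "zeta_reg s = 0"
  shows "zeta_reg (1 - s) = 0"
proof -
  have "(1 - s) * of_real (2 * pi) powr (s - 1) * Gamma ((1 + s) / 2) * Gamma ((1 - s) / 2) * zeta_reg (1 - s) = 0"
    using zeta_reg_functional_equation[OF assms(1,2)] assms(3) by simp
  moreover have "(1 + s) / 2 \<notin> \<int>\<^sub>\<le>\<^sub>0" "(1 - s) / 2 \<notin> \<int>\<^sub>\<le>\<^sub>0" "1 - s \<noteq> 0"
    using assms by (auto intro!: not_nonpos_Int_Re_pos)
  ultimately show ?thesis by (auto simp: Gamma_eq_zero_iff)
qed

text \<open>
  The functional equation solved for \<open>\<zeta>(s)\<close>. The factor \<open>1 / \<Gamma>(s / 2)\<close> that appears there is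
  \<open>(s / 2) / \<Gamma>(1 + s / 2)\<close>, whose zero at \<open>s = 0\<close> cancels the pole of \<open>\<zeta>(1 - s)\<close>: only
  \<open>-s \<zeta>(1 - s)\<close> is left, which is \<open>zeta_reg (1 - s)\<close>. The result is visibly holomorphic for \<open>Re s < 1\<close>.
\<close>

definition zeta_reflected :: "complex \<Rightarrow> complex" where
  "zeta_reflected s = - (of_real (2 * pi) powr s * Gamma (1 - s) * rGamma (1 - s / 2) * rGamma (1 + s / 2)
                          * zeta_reg (1 - s)) / 2"

lemma holomorphic_zeta_reflected: "zeta_reflected holomorphic_on {s. Re s < 1}"
  unfolding zeta_reflected_def
  by (intro holomorphic_intros holomorphic_zeta_reg_reflect) (auto intro!: not_nonpos_Int_Re_pos)

lemma zeta_reflected_eq: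
  assumes "0 < Re s" "Re s < 1"
  shows "zeta_reg s / (s - 1) = zeta_reflected s"
proof -
  have nz: "s \<noteq> 0" "s \<noteq> 1" using assms by auto
  define w where "w = complex_of_real (2 * pi)"
  have "w \<noteq> 0" by (simp add: w_def)
  have G: "Gamma (1 - s / 2) * rGamma (1 - s / 2) = 1" "Gamma (s / 2) * rGamma (s / 2) = 1"
    using assms not_nonpos_Int_Re_pos[of "1 - s / 2"] not_nonpos_Int_Re_pos[of "s / 2"]
    by (auto simp: Gamma_def rGamma_eq_zero_iff)
  have r: "rGamma (s / 2) = s / 2 * rGamma (1 + s / 2)"
    using rGamma_plus1[of "s / 2"] by (simp add: add.commute)
  have e: "(1 + (1 - s)) / 2 = 1 - s / 2" "(1 - (1 - s)) / 2 = s / 2" "1 - (1 - s) = s" "1 - s - 1 = - s"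
    by (simp_all add: field_simps)
  have FE: "(1 - s) * Gamma (1 - s) * zeta_reg (1 - s) =
          s * w powr (-s) * Gamma (1 - s / 2) * Gamma (s / 2) * zeta_reg s"
    using zeta_reg_functional_equation[of "1 - s"] assms unfolding e w_def by simp
  have "w powr s * ((1 - s) * Gamma (1 - s) * zeta_reg (1 - s)) * rGamma (1 - s / 2) * rGamma (s / 2) =
        (w powr s * w powr (-s)) * s * (Gamma (1 - s / 2) * rGamma (1 - s / 2)) * (Gamma (s / 2) * rGamma (s / 2)) * zeta_reg s"
    unfolding FE by (simp only: mult_ac)
  also have "\<dots> = s * zeta_reg s"
    using \<open>w \<noteq> 0\<close> by (simp add: G powr_add [symmetric])
  finally have "s * (w powr s * ((1 - s) * Gamma (1 - s) * zeta_reg (1 - s)) * rGamma (1 - s / 2) * rGamma (1 + s / 2) / 2) = s * zeta_reg s"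
    unfolding r by (simp add: mult_ac)
  with nz(1) have "w powr s * ((1 - s) * Gamma (1 - s) * zeta_reg (1 - s)) * rGamma (1 - s / 2) * rGamma (1 + s / 2) / 2 = zeta_reg s"
    unfolding mult_cancel_left by blast
  also have "w powr s * ((1 - s) * Gamma (1 - s) * zeta_reg (1 - s)) * rGamma (1 - s / 2) * rGamma (1 + s / 2) / 2
               = (s - 1) * zeta_reflected s"
  proof -
    have "a * ((1 - s) * b * c) * d * e / 2 = (s - 1) * (- (a * b * d * e * c) / 2)" for a b c d e :: complex
      by (simp add: field_simps)
    thus ?thesis unfolding zeta_reflected_def w_def .
  qed
  finally have "(s - 1) * zeta_reflected s = zeta_reg s" .
  thus ?thesis using nz by (simp add: field_simps)
qed

lemma riemann_zeta_unique:
  assumes f: "f holomorphic_on (- {1})" "\<And>s. Re s > 1 \<Longrightarrow> (\<lambda>n. 1 / of_nat (Suc n) powr s) sums f s" "f 1 = 0"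
    and g: "g holomorphic_on (- {1})" "\<And>s. Re s > 1 \<Longrightarrow> (\<lambda>n. 1 / of_nat (Suc n) powr s) sums g s" "g 1 = 0"
  shows "f = g"
proof
  fix s :: complex
  show "f s = g s"
  proof (cases "s = 1")
    case False
    show ?thesis
    proof (rule analytic_continuation_open[of "{s. Re s > 1}" "- {1}" f g])
      show "{s. Re s > 1} \<noteq> {}" by (auto intro: exI[of _ 2])
      show "f z = g z" if "z \<in> {s. Re s > 1}" for z
        using f(2)[of z] g(2)[of z] that sums_unique2 by auto
      show "connected (- {1 :: complex})" by (rule connected_punctured_universe) simp
    qed (use f g False in \<open>auto simp: open_halfspace_Re_gt\<close>)
  qed (use f g in simp)
qed

text \<open>
  The two formulas agree in the critical strip and so glue to a holomorphic function on the punctured plane;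
  at \<open>s = 1\<close> the value \<open>0\<close> comes from division by zero.
\<close>

lemma riemann_zeta_eq:
  "riemann_zeta = (\<lambda>s. if Re s > 0 then zeta_reg s / (s - 1) else zeta_reflected s)" (is "_ = ?Z")
  unfolding riemann_zeta_def
proof (rule the_equality)
  have "(\<lambda>s. if s \<in> {s. Re s > 0} - {1} then zeta_reg s / (s - 1) else zeta_reflected s)
          holomorphic_on ({s. Re s > 0} - {1}) \<union> {s. Re s < 1}"
  proof (rule holomorphic_on_If_Un)
    show "(\<lambda>s. zeta_reg s / (s - 1)) holomorphic_on {s. Re s > 0} - {1}"
      by (intro holomorphic_intros holomorphic_on_subset[OF holomorphic_zeta_reg]) auto
  qed (auto simp: open_halfspace_Re_gt open_halfspace_Re_lt open_delete holomorphic_zeta_reflected zeta_reflected_eq)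
  also have "({s. Re s > 0} - {1}) \<union> {s. Re s < 1} = - {1 :: complex}" by auto
  finally have "(\<lambda>s. if s \<in> {s. Re s > 0} - {1} then zeta_reg s / (s - 1) else zeta_reflected s) holomorphic_on - {1}" .
  hence hol: "?Z holomorphic_on - {1}" by (rule holomorphic_transform) auto
  show Z: "?Z holomorphic_on - {1} \<and> (\<forall>s. Re s > 1 \<longrightarrow> (\<lambda>n. 1 / of_nat (Suc n) powr s) sums ?Z s) \<and> ?Z 1 = 0"
    using hol dirichlet_series_sums by simp
  fix f :: "complex \<Rightarrow> complex"
  assume "f holomorphic_on - {1} \<and> (\<forall>s. Re s > 1 \<longrightarrow> (\<lambda>n. 1 / of_nat (Suc n) powr s) sums f s) \<and> f 1 = 0"
  with Z show "f = ?Z" by (intro riemann_zeta_unique) blast+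
qed

text \<open>
  A zero to the left of the critical line is reflected to one on the right, so only the right half of the strip
  matters. This half is contained in the union of the disks of radius \<open>1 / 2\<close> around the points \<open>1 + iy\<close>.
\<close>

lemma riemann_hypothesis_iff:
  "riemann_hypothesis \<longleftrightarrow> (\<forall>s. 1 / 2 < Re s \<and> Re s < 1 \<longrightarrow> zeta_reg s \<noteq> 0)"
proof -
  have zero: "riemann_zeta s = 0 \<longleftrightarrow> zeta_reg s = 0" if "0 < Re s" "Re s < 1" for s
    using that by (auto simp: riemann_zeta_eq)
  have "Re s = 1 / 2" if nz: "\<forall>s. 1 / 2 < Re s \<and> Re s < 1 \<longrightarrow> zeta_reg s \<noteq> 0"
    and s: "0 < Re s" "Re s < 1" "zeta_reg s = 0" for s
  proof (rule ccontr)
    assume "Re s \<noteq> 1 / 2"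
    then consider "Re s > 1 / 2" | "Re s < 1 / 2" by linarith
    thus False
    proof cases
      case 1
      thus False using nz s by blast
    next
      case 2
      thus False using nz[rule_format, of "1 - s"] s(1) zeta_reg_zero_reflect[OF s] by simp
    qed
  qed
  moreover have "zeta_reg s \<noteq> 0" if RH: riemann_hypothesis and "1 / 2 < Re s" "Re s < 1" for s
  proof -
    have "0 < Re s" using that by linarith
    thus ?thesis using RH zero[of s] that(2,3) unfolding riemann_hypothesis_def by force
  qed
  ultimately show ?thesis unfolding riemann_hypothesis_def using zero by blast
qed

section \<open>Power series at points of the line with real part 1\<close>

lemma zeta_Gamma_eq:
  assumes "Re s > 0"
  shows "zeta_Gamma s = zeta_reg s * Gamma s"
  using assms by (simp add: zeta_Gamma_def riemann_zeta_eq)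

lemma zeta_Gamma_eq_0_iff:
  assumes "Re s > 0"
  shows "zeta_Gamma s = 0 \<longleftrightarrow> zeta_reg s = 0"
  using assms not_nonpos_Int_Re_pos[OF assms] by (simp add: zeta_Gamma_eq Gamma_eq_zero_iff)

lemma Re_ball_s0:
  assumes "s \<in> ball (s0 y) r"
  shows "\<bar>Re s - 1\<bar> < r"
  using assms abs_Re_le_cmod[of "s0 y - s"] by (simp add: dist_norm s0_def abs_minus_commute)

lemma zeta_Gamma_holomorphic: "zeta_Gamma holomorphic_on ball (s0 y) 1"
proof -
  have "(\<lambda>s. zeta_reg s * Gamma s) holomorphic_on {s. Re s > 0}"
    by (intro holomorphic_intros holomorphic_zeta_reg) (auto intro: not_nonpos_Int_Re_pos dest: not_nonpos_Int_Re_pos)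
  hence "(\<lambda>s. zeta_reg s * Gamma s) holomorphic_on ball (s0 y) 1"
    by (rule holomorphic_on_subset) (use Re_ball_s0[of _ y 1] in force)
  thus ?thesis
    by (rule holomorphic_transform) (use Re_ball_s0[of _ y 1] in \<open>force simp: zeta_Gamma_eq\<close>)
qed

lemma conv_radius_b_series: "fps_conv_radius (b_series y) \<ge> 1"
  and eval_b_series: "s \<in> ball (s0 y) 1 \<Longrightarrow> eval_fps (b_series y) (s - s0 y) = zeta_Gamma s"
proof -
  have "zeta_Gamma holomorphic_on eball (s0 y) 1"
    using zeta_Gamma_holomorphic[of y] by (simp add: one_ereal_def)
  from conv_radius_fps_expansion[OF this] eval_fps_expansion[OF this]
  show "fps_conv_radius (b_series y) \<ge> 1"
    and "s \<in> ball (s0 y) 1 \<Longrightarrow> eval_fps (b_series y) (s - s0 y) = zeta_Gamma s"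
    by (simp_all add: b_series_def one_ereal_def)
qed

lemma b_series_nth_0: "fps_nth (b_series y) 0 \<noteq> 0"
proof -
  have "Re (s0 y) = 1" by (simp add: s0_def)
  hence "zeta_Gamma (s0 y) \<noteq> 0" by (simp add: zeta_Gamma_eq_0_iff zeta_reg_nonzero)
  thus ?thesis using eval_b_series[of "s0 y" y] by (simp add: eval_fps_at_0)
qed

text \<open>
  Besides the right half of the critical strip the disks only cover points with \<open>1 \<le> Re s\<close>, where zeta has no zeros.
  Conversely \<open>s\<close> with \<open>1 / 2 < Re s < 1\<close> lies in the disk at its own height.
\<close>

lemma riemann_hypothesis_iff_b_series:
  "riemann_hypothesis \<longleftrightarrow> (\<forall>y. \<forall>s \<in> ball (s0 y) (1 / 2). eval_fps (b_series y) (s - s0 y) \<noteq> 0)"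
proof -
  have eval: "eval_fps (b_series y) (s - s0 y) = 0 \<longleftrightarrow> zeta_reg s = 0" if "s \<in> ball (s0 y) (1 / 2)" for y s
  proof -
    have "Re s > 0" using Re_ball_s0[OF that] by linarith
    moreover have "s \<in> ball (s0 y) 1" using that by auto
    ultimately show ?thesis by (simp only: eval_b_series zeta_Gamma_eq_0_iff)
  qed
  show ?thesis unfolding riemann_hypothesis_iff
  proof (intro iffI allI ballI impI)
    fix y s assume RH: "\<forall>s. 1 / 2 < Re s \<and> Re s < 1 \<longrightarrow> zeta_reg s \<noteq> 0" and s: "s \<in> ball (s0 y) (1 / 2)"
    have "zeta_reg s \<noteq> 0"
      using RH zeta_reg_nonzero[of s] Re_ball_s0[OF s] by (cases "Re s < 1") auto
    thus "eval_fps (b_series y) (s - s0 y) \<noteq> 0" using eval[OF s] by simp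
  next
    fix s assume nz: "\<forall>y. \<forall>s \<in> ball (s0 y) (1 / 2). eval_fps (b_series y) (s - s0 y) \<noteq> 0"
      and s: "1 / 2 < Re s \<and> Re s < 1"
    have "s0 (Im s) - s = of_real (1 - Re s)" by (simp add: s0_def complex_eq_iff)
    hence "dist (s0 (Im s)) s = 1 - Re s" unfolding dist_norm using s by (simp del: of_real_diff)
    hence "s \<in> ball (s0 (Im s)) (1 / 2)" using s by simp
    thus "zeta_reg s \<noteq> 0" using nz eval by blast
  qed
qed

lemma half_ereal: "(1 / 2 :: ereal) = ereal (1 / 2)"
  by (simp add: one_ereal_def divide_ereal_def)

text \<open>
  If the reciprocal series converges on the disk, then the product of the two sums is \<open>1\<close> there and excludes zeros;
  if there are no zeros, the reciprocal function is holomorphic on the disk and its Taylor series converges.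
\<close>

lemma conv_radius_c_series_iff:
  "fps_conv_radius (c_series y) \<ge> 1 / 2 \<longleftrightarrow>
     (\<forall>s \<in> ball (s0 y) (1 / 2). eval_fps (b_series y) (s - s0 y) \<noteq> 0)"
proof
  assume R: "fps_conv_radius (c_series y) \<ge> 1 / 2"
  show "\<forall>s \<in> ball (s0 y) (1 / 2). eval_fps (b_series y) (s - s0 y) \<noteq> 0"
  proof
    fix s assume "s \<in> ball (s0 y) (1 / 2)"
    hence z: "norm (s - s0 y) < 1 / 2" by (simp add: dist_norm norm_minus_commute)
    have "ereal (norm (s - s0 y)) < fps_conv_radius (c_series y)"
      using z R half_ereal by (metis ereal_less_eq(3) less_ereal.simps(1) order_less_le_trans)
    moreover have "ereal (norm (s - s0 y)) < fps_conv_radius (b_series y)"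
      using z conv_radius_b_series[of y] by (intro less_le_trans[OF _ conv_radius_b_series]) (simp add: one_ereal_def)
    ultimately have "eval_fps (b_series y * c_series y) (s - s0 y) =
        eval_fps (b_series y) (s - s0 y) * eval_fps (c_series y) (s - s0 y)"
      by (intro eval_fps_mult)
    moreover have "b_series y * c_series y = 1"
      unfolding c_series_def using inverse_mult_eq_1[OF b_series_nth_0] by (simp add: mult.commute)
    ultimately show "eval_fps (b_series y) (s - s0 y) \<noteq> 0" by auto
  qed
next
  assume nz: "\<forall>s \<in> ball (s0 y) (1 / 2). eval_fps (b_series y) (s - s0 y) \<noteq> 0"
  have "eval_fps (b_series y) z \<noteq> 0" if "ereal (norm z) < 1 / 2" for z
    using nz[rule_format, of "s0 y + z"] that unfolding half_ereal by (simp add: dist_norm)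
  hence "fps_conv_radius (c_series y) \<ge> min (1 / 2) (fps_conv_radius (b_series y))"
    unfolding c_series_def by (rule fps_conv_radius_inverse)
  moreover have "(1 / 2 :: ereal) \<le> fps_conv_radius (b_series y)"
    unfolding half_ereal by (rule order_trans[OF _ conv_radius_b_series]) (simp add: one_ereal_def)
  ultimately show "fps_conv_radius (c_series y) \<ge> 1 / 2" by (simp add: min_def)
qed

theorem theorem4p1:
  shows "(riemann_hypothesis \<longleftrightarrow>
            (\<forall>y::real. \<forall>s \<in> ball (s0 y) (1 / 2). eval_fps (b_series y) (s - s0 y) \<noteq> 0)) \<and>
         (riemann_hypothesis \<longleftrightarrow>
            (\<forall>y::real. fps_conv_radius (c_series y) \<ge> 1 / 2))"
  unfolding conv_radius_c_series_iff using riemann_hypothesis_iff_b_series by blast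

end
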